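(* Let $\omega=(\omega^1,\omega^2,\omega^3)$ be an $(I,J,K)$-generalized Finsler structure on a closed 3-manifold $\Sigma$. Then: 1. $(\omega^1,\omega^2)$ is a taut contact circle if and only if $I=0$, i.e. $(\Sigma,\omega)$ is in fact a $\mathcal{K}$-Cartan structure with $\mathcal{K}:=K$. 2. $(\omega^1,\omega^3)$ is a taut contact circle if and only if $K=1$, i.e. $(\Sigma,\omega)$ is an $(I,J,1)$-generalized Finsler structure. This taut contact circle is actually a $\mathcal{K}$-Cartan structure on $\Sigma$ (for some smooth function $\mathcal{K}$ on $\Sigma$). 3. $(\omega^2,\omega^3)$ is a taut contact circle if and only if $K=1$ and $J=0$. Moreover, in this case $I=0$ and $(\Sigma,\omega)$ is a $1$-Cartan structure.
   Context: An $(I,J,K)$-generalized Finsler structure on a 3-manifold $\Sigma$ is a global coframing $\omega=(\omega^1,\omega^2,\omega^3)$ satisfying $$d\omega^1=-I\,\omega^1\wedge\omega^3+\omega^2\wedge\omega^3,\quad d\omega^2=-\omega^1\wedge\omega^3,\quad d\omega^3=K\,\omega^1\wedge\omega^2-J\,\omega^1\wedge\omega^3,$$ with $I,J,K$ smooth functions on $\Sigma$. A contact circle is a pair of contact forms $(\alpha^1,\alpha^2)$ such that $\lambda_1\alpha^1+\lambda_2\alpha^2$ is a contact form for all real $\lambda_1,\lambda_2$ with $\lambda_1^2+\lambda_2^2=1$. It is taut if all these combinations define the same volume form; equivalently $\alpha^1\wedge d\alpha^1=\alpha^2\wedge d\alpha^2\neq 0$ everywhere and $\alpha^1\wedge d\alpha^2+\alpha^2\wedge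 d\alpha^1=0$. A Cartan structure is a pair $(\alpha^1,\alpha^2)$ with $\alpha^1\wedge d\alpha^1=\alpha^2\wedge d\alpha^2\neq 0$ everywhere and $\alpha^1\wedge d\alpha^2=0=\alpha^2\wedge d\alpha^1$. For a Cartan structure there is a unique 1-form $\eta$ with $d\alpha^1=\alpha^2\wedge\eta$, $d\alpha^2=\eta\wedge\alpha^1$; it is a $\mathcal{K}$-Cartan structure if moreover $d\eta=\mathcal{K}\,\alpha^1\wedge\alpha^2$ for a function $\mathcal{K}$. The coframe $(\alpha^1,\alpha^2,\eta)$ is then also called a $\mathcal{K}$-Cartan structure; a $\mathcal{K}$-Cartan coframe is the same thing as a $(0,0,\mathcal{K})$-generalized Finsler structure. *)

theory Defs
  imports "HOL-Analysis.Analysis" "HOL-Library.Function_Algebras"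
begin

text \<open>Sums, differences and negatives of forms below are the pointwise ones of
  \<^theory>\<open>HOL-Library.Function_Algebras\<close>.\<close>

section \<open>Smooth 3-manifolds\<close>

primrec Ck_on :: "nat \<Rightarrow> 'a::real_normed_vector set \<Rightarrow> ('a \<Rightarrow> 'b::real_normed_vector) \<Rightarrow> bool" where
  "Ck_on 0 S f \<longleftrightarrow> continuous_on S f"
| "Ck_on (Suc k) S f \<longleftrightarrow> (\<forall>x\<in>S. f differentiable (at x)) \<and>
     (\<forall>v. Ck_on k S (\<lambda>x. frechet_derivative f (at x) v))"

text \<open>This is only used for open sets \<open>S\<close> in finite-dimensional spaces.\<close>

definition smooth_on :: "'a::real_normed_vector set \<Rightarrow> ('a \<Rightarrow> 'b::real_normed_vector) \<Rightarrow> bool" where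
  "smooth_on S f \<longleftrightarrow> (\<forall>k. Ck_on k S f)"

text \<open>A chart \<open>(U, \<phi>)\<close>; only the values of \<open>\<phi>\<close> on \<open>U\<close> are relevant.\<close>

type_synonym 'a chart = "'a set \<times> ('a \<Rightarrow> real^3)"

definition chart_image :: "'a chart \<Rightarrow> (real^3) set" where
  "chart_image c = snd c ` fst c"

definition chart_inv :: "'a chart \<Rightarrow> real^3 \<Rightarrow> 'a" where
  "chart_inv c = inv_into (fst c) (snd c)"

definition chart_on :: "'a topology \<Rightarrow> 'a chart \<Rightarrow> bool" where
  "chart_on M c \<longleftrightarrow> openin M (fst c) \<and> open (chart_image c) \<and>
     homeomorphic_map (subtopology M (fst c)) (top_of_set (chart_image c)) (snd c)"

definition transition :: "'a chart \<Rightarrow> 'a chart \<Rightarrow> real^3 \<Rightarrow> real^3" where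
  "transition c c' = snd c' \<circ> chart_inv c"

definition transition_dom :: "'a chart \<Rightarrow> 'a chart \<Rightarrow> (real^3) set" where
  "transition_dom c c' = snd c ` (fst c \<inter> fst c')"

definition smooth_atlas :: "'a topology \<Rightarrow> 'a chart set \<Rightarrow> bool" where
  "smooth_atlas M A \<longleftrightarrow> (\<forall>c\<in>A. chart_on M c) \<and> (\<Union>c\<in>A. fst c) = topspace M \<and>
     (\<forall>c\<in>A. \<forall>c'\<in>A. smooth_on (transition_dom c c') (transition c c'))"

definition smooth_3manifold :: "'a topology \<Rightarrow> 'a chart set \<Rightarrow> bool" where
  "smooth_3manifold M A \<longleftrightarrow> Hausdorff_space M \<and> second_countable M \<and> smooth_atlas M A"

text \<open>Charts map onto open subsets of \<open>\<real>\<^sup>3\<close>, so there is no boundary.\<close>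

definition closed_3manifold :: "'a topology \<Rightarrow> 'a chart set \<Rightarrow> bool" where
  "closed_3manifold M A \<longleftrightarrow> smooth_3manifold M A \<and> compact_space M"

definition smooth_fun :: "'a chart set \<Rightarrow> ('a \<Rightarrow> real) \<Rightarrow> bool" where
  "smooth_fun A f \<longleftrightarrow> (\<forall>c\<in>A. smooth_on (chart_image c) (f \<circ> chart_inv c))"


section \<open>Differential forms\<close>

text \<open>As in Bott and Tu, a differential form on a manifold with atlas \<open>A\<close> is a family of forms
  on the images of the charts in \<open>A\<close> compatible under pullback along the transition maps:
  \<open>\<alpha> c x u\<close> is the value at the point \<open>x\<close> of the image of \<open>c\<close> on the tangent vector \<open>u\<close>.
  Values at points outside the chart image, or on charts outside \<open>A\<close>, carry no meaning;
  \<open>form_eq\<close> is equality of forms up to such values.\<close>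

type_synonym 'a form1 = "'a chart \<Rightarrow> real^3 \<Rightarrow> real^3 \<Rightarrow> real"
type_synonym 'a form2 = "'a chart \<Rightarrow> real^3 \<Rightarrow> real^3 \<Rightarrow> real^3 \<Rightarrow> real"
type_synonym 'a form3 = "'a chart \<Rightarrow> real^3 \<Rightarrow> real^3 \<Rightarrow> real^3 \<Rightarrow> real^3 \<Rightarrow> real"

definition form_eq :: "'a chart set \<Rightarrow> ('a chart \<Rightarrow> real^3 \<Rightarrow> 'b) \<Rightarrow> ('a chart \<Rightarrow> real^3 \<Rightarrow> 'b) \<Rightarrow> bool" where
  "form_eq A \<beta> \<gamma> \<longleftrightarrow> (\<forall>c\<in>A. \<forall>x\<in>chart_image c. \<beta> c x = \<gamma> c x)"

definition nowhere_zero :: "'a chart set \<Rightarrow> ('a chart \<Rightarrow> real^3 \<Rightarrow> 'b::zero) \<Rightarrow> bool" where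
  "nowhere_zero A \<beta> \<longleftrightarrow> (\<forall>c\<in>A. \<forall>x\<in>chart_image c. \<beta> c x \<noteq> 0)"

definition smooth_form1 :: "'a chart set \<Rightarrow> 'a form1 \<Rightarrow> bool" where
  "smooth_form1 A \<alpha> \<longleftrightarrow>
     (\<forall>c\<in>A. (\<forall>x\<in>chart_image c. linear (\<alpha> c x)) \<and> (\<forall>u. smooth_on (chart_image c) (\<lambda>x. \<alpha> c x u))) \<and>
     (\<forall>c\<in>A. \<forall>c'\<in>A. \<forall>x\<in>transition_dom c c'. \<forall>u.
        \<alpha> c x u = \<alpha> c' (transition c c' x) (frechet_derivative (transition c c') (at x) u))"

definition scale2 :: "('a \<Rightarrow> real) \<Rightarrow> 'a form2 \<Rightarrow> 'a form2" (infixr "\<odot>" 75) where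
  "(f \<odot> \<beta>) c x u v = f (chart_inv c x) * \<beta> c x u v"

definition lincomb1 :: "real \<Rightarrow> 'a form1 \<Rightarrow> real \<Rightarrow> 'a form1 \<Rightarrow> 'a form1" where
  "lincomb1 l1 \<alpha>1 l2 \<alpha>2 c x u = l1 * \<alpha>1 c x u + l2 * \<alpha>2 c x u"

definition wedge11 :: "'a form1 \<Rightarrow> 'a form1 \<Rightarrow> 'a form2" (infixr "\<^bold>\<and>" 80) where
  "(\<alpha> \<^bold>\<and> \<beta>) c x u v = \<alpha> c x u * \<beta> c x v - \<alpha> c x v * \<beta> c x u"

definition wedge12 :: "'a form1 \<Rightarrow> 'a form2 \<Rightarrow> 'a form3" (infixr "\<^bold>\<and>\<^sub>2" 80) where
  "(\<alpha> \<^bold>\<and>\<^sub>2 \<beta>) c x u v w = \<alpha> c x u * \<beta> c x v w - \<alpha> c x v * \<beta> c x u w + \<alpha> c x w * \<beta> c x u v"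

text \<open>The usual \<open>d\<alpha>(u, v) = u(\<alpha>(v)) - v(\<alpha>(u)) - \<alpha>([u, v])\<close>, for the constant (hence commuting)
  vector fields \<open>u\<close> and \<open>v\<close> in the chart.\<close>

definition ext_d :: "'a form1 \<Rightarrow> 'a form2" where
  "ext_d \<alpha> c x u v = frechet_derivative (\<lambda>y. \<alpha> c y v) (at x) u
                   - frechet_derivative (\<lambda>y. \<alpha> c y u) (at x) v"


section \<open>Generalized Finsler structures\<close>

definition coframing :: "'a chart set \<Rightarrow> 'a form1 \<Rightarrow> 'a form1 \<Rightarrow> 'a form1 \<Rightarrow> bool" where
  "coframing A \<omega>1 \<omega>2 \<omega>3 \<longleftrightarrow> smooth_form1 A \<omega>1 \<and> smooth_form1 A \<omega>2 \<and> smooth_form1 A \<omega>3 \<and>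
     (\<forall>c\<in>A. \<forall>x\<in>chart_image c. \<forall>a1 a2 a3.
        (\<forall>u. a1 * \<omega>1 c x u + a2 * \<omega>2 c x u + a3 * \<omega>3 c x u = 0) \<longrightarrow> a1 = 0 \<and> a2 = 0 \<and> a3 = 0)"

definition gen_finsler ::
  "'a chart set \<Rightarrow> ('a \<Rightarrow> real) \<Rightarrow> ('a \<Rightarrow> real) \<Rightarrow> ('a \<Rightarrow> real) \<Rightarrow> 'a form1 \<Rightarrow> 'a form1 \<Rightarrow> 'a form1 \<Rightarrow> bool"
where
  "gen_finsler A I J K \<omega>1 \<omega>2 \<omega>3 \<longleftrightarrow>
     coframing A \<omega>1 \<omega>2 \<omega>3 \<and> smooth_fun A I \<and> smooth_fun A J \<and> smooth_fun A K \<and>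
     form_eq A (ext_d \<omega>1) (- (I \<odot> \<omega>1 \<^bold>\<and> \<omega>3) + \<omega>2 \<^bold>\<and> \<omega>3) \<and>
     form_eq A (ext_d \<omega>2) (- (\<omega>1 \<^bold>\<and> \<omega>3)) \<and>
     form_eq A (ext_d \<omega>3) (K \<odot> \<omega>1 \<^bold>\<and> \<omega>2 - J \<odot> \<omega>1 \<^bold>\<and> \<omega>3)"


section \<open>Contact circles and Cartan structures\<close>

definition contact_form :: "'a chart set \<Rightarrow> 'a form1 \<Rightarrow> bool" where
  "contact_form A \<alpha> \<longleftrightarrow> smooth_form1 A \<alpha> \<and> nowhere_zero A (\<alpha> \<^bold>\<and>\<^sub>2 ext_d \<alpha>)"

definition contact_circle :: "'a chart set \<Rightarrow> 'a form1 \<Rightarrow> 'a form1 \<Rightarrow> bool" where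
  "contact_circle A \<alpha>1 \<alpha>2 \<longleftrightarrow> contact_form A \<alpha>1 \<and> contact_form A \<alpha>2 \<and>
     (\<forall>l1 l2. l1\<^sup>2 + l2\<^sup>2 = 1 \<longrightarrow> contact_form A (lincomb1 l1 \<alpha>1 l2 \<alpha>2))"

definition taut_contact_circle :: "'a chart set \<Rightarrow> 'a form1 \<Rightarrow> 'a form1 \<Rightarrow> bool" where
  "taut_contact_circle A \<alpha>1 \<alpha>2 \<longleftrightarrow> contact_circle A \<alpha>1 \<alpha>2 \<and>
     (\<forall>l1 l2 m1 m2. l1\<^sup>2 + l2\<^sup>2 = 1 \<longrightarrow> m1\<^sup>2 + m2\<^sup>2 = 1 \<longrightarrow>
        form_eq A (lincomb1 l1 \<alpha>1 l2 \<alpha>2 \<^bold>\<and>\<^sub>2 ext_d (lincomb1 l1 \<alpha>1 l2 \<alpha>2))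
                  (lincomb1 m1 \<alpha>1 m2 \<alpha>2 \<^bold>\<and>\<^sub>2 ext_d (lincomb1 m1 \<alpha>1 m2 \<alpha>2)))"

definition cartan_structure :: "'a chart set \<Rightarrow> 'a form1 \<Rightarrow> 'a form1 \<Rightarrow> bool" where
  "cartan_structure A \<alpha>1 \<alpha>2 \<longleftrightarrow> smooth_form1 A \<alpha>1 \<and> smooth_form1 A \<alpha>2 \<and>
     form_eq A (\<alpha>1 \<^bold>\<and>\<^sub>2 ext_d \<alpha>1) (\<alpha>2 \<^bold>\<and>\<^sub>2 ext_d \<alpha>2) \<and>
     nowhere_zero A (\<alpha>1 \<^bold>\<and>\<^sub>2 ext_d \<alpha>1) \<and>
     form_eq A (\<alpha>1 \<^bold>\<and>\<^sub>2 ext_d \<alpha>2) 0 \<and> form_eq A (\<alpha>2 \<^bold>\<and>\<^sub>2 ext_d \<alpha>1) 0"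

definition K_cartan_coframe ::
  "'a chart set \<Rightarrow> ('a \<Rightarrow> real) \<Rightarrow> 'a form1 \<Rightarrow> 'a form1 \<Rightarrow> 'a form1 \<Rightarrow> bool"
where
  "K_cartan_coframe A \<kappa> \<alpha>1 \<alpha>2 \<eta> \<longleftrightarrow> cartan_structure A \<alpha>1 \<alpha>2 \<and> smooth_form1 A \<eta> \<and>
     form_eq A (ext_d \<alpha>1) (\<alpha>2 \<^bold>\<and> \<eta>) \<and> form_eq A (ext_d \<alpha>2) (\<eta> \<^bold>\<and> \<alpha>1) \<and>
     form_eq A (ext_d \<eta>) (\<kappa> \<odot> \<alpha>1 \<^bold>\<and> \<alpha>2)"

text \<open>The form \<open>\<eta>\<close> of a Cartan structure is unique, so the existential quantifier
  refers to that one form.\<close>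

definition K_cartan_structure :: "'a chart set \<Rightarrow> ('a \<Rightarrow> real) \<Rightarrow> 'a form1 \<Rightarrow> 'a form1 \<Rightarrow> bool" where
  "K_cartan_structure A \<kappa> \<alpha>1 \<alpha>2 \<longleftrightarrow> (\<exists>\<eta>. K_cartan_coframe A \<kappa> \<alpha>1 \<alpha>2 \<eta>)"

end

theory Submission
  imports Defs
begin

text \<open>Every \<open>\<omega>i \<and> d\<omega>j\<close> is a function multiple of the volume form \<open>\<omega>1 \<and> \<omega>2 \<and> \<omega>3\<close>; the structure equations
  give the multiples, and tautness of a pair is a condition on them. The remaining claims use
  \<open>d \<circ> d = 0\<close>: if \<open>I = 0\<close> then \<open>d\<omega>1 = \<omega>2 \<and> \<omega>3\<close> is closed, so \<open>J = 0\<close>; if \<open>K = 1\<close> and \<open>J = 0\<close> then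
  \<open>d\<omega>3 = \<omega>1 \<and> \<omega>2\<close> is closed, so \<open>I = 0\<close>. If \<open>K = 1\<close>, the form belonging to \<open>(\<omega>1, \<omega>3)\<close> is
  \<open>\<eta> = I \<omega>1 - \<omega>2 + J \<omega>3\<close>: then \<open>d\<omega>1 = \<omega>3 \<and> \<eta>\<close> and \<open>d\<omega>3 = \<eta> \<and> \<omega>1\<close> are closed, whence
  \<open>\<omega>1 \<and> d\<eta> = \<omega>3 \<and> d\<eta> = 0\<close> and \<open>d\<eta>\<close> is a multiple of \<open>\<omega>1 \<and> \<omega>3\<close>.\<close>

section \<open>Smooth functions on open sets\<close>

text \<open>The mean value theorem applies twice: first in the direction \<open>u\<close> to the
  difference of \<open>f\<close> along two parallel segments, then in the direction \<open>v\<close>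
  to the derivative \<open>F\<close>. The quotient thereby equals the iterated derivative
  \<open>G\<close> at a point that tends to \<open>x\<close>, and \<open>G\<close> is continuous
  there.\<close>

lemma second_difference_quotient:
  fixes f :: "'a::real_normed_vector \<Rightarrow> real"
  assumes S: "open S" "x \<in> S" and f: "\<And>y. y \<in> S \<Longrightarrow> f differentiable at y"
    and f1: "\<And>y. y \<in> S \<Longrightarrow> (\<lambda>z. frechet_derivative f (at z) u) differentiable at y"
    and f2: "continuous_on S (\<lambda>y. frechet_derivative (\<lambda>z. frechet_derivative f (at z) u) (at y) v)"
  shows "((\<lambda>t. (f (x + t *\<^sub>R u + t *\<^sub>R v) - f (x + t *\<^sub>R u) - f (x + t *\<^sub>R v) + f x) / t\<^sup>2) \<longlongrightarrow>
    frechet_derivative (\<lambda>z. frechet_derivative f (at z) u) (at x) v) (at_right 0)"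
proof (rule tendstoI)
  define F where "F = (\<lambda>z. frechet_derivative f (at z) u)"
  define G where "G = (\<lambda>y. frechet_derivative F (at y) v)"
  fix e :: real assume e: "e > 0"
  have "isCont G x" using f2 S unfolding F_def G_def by (simp add: continuous_on_eq_continuous_at)
  then have "\<exists>d>0. \<forall>y. dist y x < d \<longrightarrow> dist (G y) (G x) < e"
    using e by (simp add: continuous_at_eps_delta dist_norm)
  then obtain d1 where d1: "d1 > 0" "\<And>y. dist y x < d1 \<Longrightarrow> dist (G y) (G x) < e"
    by blast
  obtain d2 where d2: "d2 > 0" "ball x d2 \<subseteq> S" using S by (meson open_contains_ball)
  \<comment> \<open>The summand 1 keeps \<open>N\<close> positive when \<open>u\<close> and
    \<open>v\<close> both vanish and makes the estimate by \<open>t * N\<close> strict.\<close>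
  define N where "N = norm u + norm v + 1"
  have N: "N > 0" unfolding N_def by (simp add: add_nonneg_pos)
  define d where "d = min d1 d2 / N"
  have d: "d > 0" using d1 d2 N by (simp add: d_def)
  have near: "dist (x + s *\<^sub>R u + r *\<^sub>R v) x < min d1 d2" if "0 \<le> s" "s \<le> t" "0 \<le> r" "r \<le> t" "0 < t" "t < d" for s r t
  proof -
    have "dist (x + s *\<^sub>R u + r *\<^sub>R v) x = norm (s *\<^sub>R u + r *\<^sub>R v)" by (simp add: dist_norm)
    also have "\<dots> \<le> s * norm u + r * norm v" using that norm_triangle_ineq[of "s *\<^sub>R u" "r *\<^sub>R v"] by simp
    also have "\<dots> \<le> t * norm u + t * norm v" using that by (intro add_mono mult_right_mono) auto
    also have "\<dots> < t * N" using that by (simp add: N_def algebra_simps)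
    also have "\<dots> < d * N" using that N by simp
    also have "\<dots> = min d1 d2" using N by (simp add: d_def)
    finally show ?thesis .
  qed
  have inS: "x + s *\<^sub>R u + r *\<^sub>R v \<in> S" if "0 \<le> s" "s \<le> t" "0 \<le> r" "r \<le> t" "0 < t" "t < d" for s r t
    using near[OF that] d2 by (auto simp: dist_commute)
  have Df: "((\<lambda>s. g (p + s *\<^sub>R w)) has_real_derivative frechet_derivative g (at (p + s *\<^sub>R w)) w) (at s)"
    if "g differentiable at (p + s *\<^sub>R w)" for g :: "'a \<Rightarrow> real" and p w s
  proof -
    have "(g has_derivative frechet_derivative g (at (p + s *\<^sub>R w))) (at (p + s *\<^sub>R w))"
      using that by (simp add: frechet_derivative_works)
    then have "((\<lambda>s. g (p + s *\<^sub>R w)) has_derivative (\<lambda>h. frechet_derivative g (at (p + s *\<^sub>R w)) (h *\<^sub>R w))) (at s)"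
      by (intro has_derivative_compose[where g = g and f = "\<lambda>s. p + s *\<^sub>R w"]) (auto intro!: derivative_eq_intros)
    then show ?thesis
      unfolding has_field_derivative_def
      by (rule has_derivative_eq_rhs) (simp add: fun_eq_iff linear_cmul[OF linear_frechet_derivative[OF that]])
  qed
  have main: "dist ((f (x + t *\<^sub>R u + t *\<^sub>R v) - f (x + t *\<^sub>R u) - f (x + t *\<^sub>R v) + f x) / t\<^sup>2) (G x) < e"
    if t: "0 < t" "t < d" for t
  proof -
    have "((\<lambda>s. f (x + s *\<^sub>R u + t *\<^sub>R v) - f (x + s *\<^sub>R u)) has_real_derivative
        F (x + s *\<^sub>R u + t *\<^sub>R v) - F (x + s *\<^sub>R u)) (at s)" if "0 \<le> s" "s \<le> t" for s
      using Df[of f "x + t *\<^sub>R v" s u] Df[of f x s u] f[OF inS[of s t t]] f[OF inS[of s t 0]] that t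
      by (auto simp: F_def algebra_simps intro!: DERIV_diff)
    from MVT2[OF t(1) this] obtain s where s: "0 < s" "s < t" and
      1: "f (x + t *\<^sub>R u + t *\<^sub>R v) - f (x + t *\<^sub>R u) - (f (x + t *\<^sub>R v) - f x) =
        t * (F (x + s *\<^sub>R u + t *\<^sub>R v) - F (x + s *\<^sub>R u))" by auto
    have "((\<lambda>r. F (x + s *\<^sub>R u + r *\<^sub>R v)) has_real_derivative G (x + s *\<^sub>R u + r *\<^sub>R v)) (at r)"
      if "0 \<le> r" "r \<le> t" for r
      using Df[of F "x + s *\<^sub>R u" r v] f1[OF inS[of s t r]] that s t by (simp add: F_def G_def)
    from MVT2[OF t(1) this] obtain r where r: "0 < r" "r < t" and
      2: "F (x + s *\<^sub>R u + t *\<^sub>R v) - F (x + s *\<^sub>R u) = t * G (x + s *\<^sub>R u + r *\<^sub>R v)" by auto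
    have "(f (x + t *\<^sub>R u + t *\<^sub>R v) - f (x + t *\<^sub>R u) - f (x + t *\<^sub>R v) + f x) / t\<^sup>2 = G (x + s *\<^sub>R u + r *\<^sub>R v)"
      using 1 2 t by (simp add: power2_eq_square field_simps)
    moreover have "dist (G (x + s *\<^sub>R u + r *\<^sub>R v)) (G x) < e"
      using near[of s t r] s r t by (intro d1) auto
    ultimately show ?thesis by simp
  qed
  show "\<forall>\<^sub>F t in at_right 0. dist ((f (x + t *\<^sub>R u + t *\<^sub>R v) - f (x + t *\<^sub>R u) - f (x + t *\<^sub>R v) + f x) / t\<^sup>2)
      (frechet_derivative (\<lambda>z. frechet_derivative f (at z) u) (at x) v) < e"
    unfolding eventually_at_right_field using main d by (intro exI[of _ d]) (simp add: G_def F_def)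
qed

text \<open>The second difference quotient does not change when \<open>u\<close> and
  \<open>v\<close> are exchanged, and it converges to either side of the equation. This symmetry is
  the source of both \<open>d \<circ> d = 0\<close> and the naturality of \<open>d\<close>.\<close>

lemma symmetric_second_frechet_derivative:
  fixes f :: "'a::real_normed_vector \<Rightarrow> real"
  assumes S: "open S" "x \<in> S" and f: "Ck_on 2 S f"
  shows "frechet_derivative (\<lambda>z. frechet_derivative f (at z) u) (at x) v =
    frechet_derivative (\<lambda>z. frechet_derivative f (at z) v) (at x) u"
proof -
  have "((\<lambda>t. (f (x + t *\<^sub>R u + t *\<^sub>R v) - f (x + t *\<^sub>R u) - f (x + t *\<^sub>R v) + f x) / t\<^sup>2) \<longlongrightarrow>
    frechet_derivative (\<lambda>z. frechet_derivative f (at z) u) (at x) v) (at_right 0)" for u v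
    using second_difference_quotient[OF S] f by (simp add: numeral_2_eq_2)
  from this[of u v] this[of v u] show ?thesis
    by (intro tendsto_unique[of "at_right (0::real)"]) (auto simp: algebra_simps)
qed

section \<open>Closure properties of C^k and smooth functions\<close>

text \<open>Derivatives are taken with respect to full neighbourhoods. Since \<open>S\<close> is
  open, each point of \<open>S\<close> has one inside \<open>S\<close>, so values elsewhere have no
  influence.\<close>

lemma Ck_on_cong:
  "open S \<Longrightarrow> (\<And>x. x \<in> S \<Longrightarrow> f x = g x) \<Longrightarrow> Ck_on k S f \<Longrightarrow> Ck_on k S g"
proof (induction k arbitrary: f g)
  case 0 then show ?case by (auto cong: continuous_on_cong)
next
  case (Suc k)
  have "(f has_derivative D) (at x) \<longleftrightarrow> (g has_derivative D) (at x)" if "x \<in> S" for x D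
    using has_derivative_transform_within_open[of f D x UNIV S g] has_derivative_transform_within_open[of g D x UNIV S f]
      that Suc.prems by auto
  then have 1: "f differentiable at x \<longleftrightarrow> g differentiable at x"
    "frechet_derivative f (at x) = frechet_derivative g (at x)" if "x \<in> S" for x
    using that unfolding differentiable_def frechet_derivative_def by auto
  have "Ck_on k S (\<lambda>x. frechet_derivative g (at x) v)" for v
    by (rule Suc.IH[of "\<lambda>x. frechet_derivative f (at x) v"]) (use Suc.prems 1 in auto)
  with Suc.prems 1 show ?case by auto
qed

lemma Ck_on_SucD: "Ck_on (Suc k) S f \<Longrightarrow> Ck_on k S f"
proof (induction k arbitrary: f)
  case 0 then show ?case
    by (auto intro: differentiable_imp_continuous_within continuous_at_imp_continuous_on)
next
  case (Suc k)
  note IH = Suc.IH and prems = Suc.prems[unfolded Ck_on.simps(2)[of "Suc k"]]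
  show ?case unfolding Ck_on.simps(2)[of k] using IH prems by blast
qed

lemma Ck_on_const: "Ck_on k S (\<lambda>x. c)"
  by (induction k arbitrary: c) auto

lemma frechet_derivative_eqI: "(f has_derivative D) (at x) \<Longrightarrow> frechet_derivative f (at x) = D"
  by (metis frechet_derivative_at)

lemma Ck_on_add:
  assumes "open S"
  shows "Ck_on k S f \<Longrightarrow> Ck_on k S g \<Longrightarrow> Ck_on k S (\<lambda>x. f x + g x)"
proof (induction k arbitrary: f g)
  case 0 then show ?case by (auto intro: continuous_intros)
next
  case (Suc k)
  have D: "((\<lambda>x. f x + g x) has_derivative
      (\<lambda>v. frechet_derivative f (at x) v + frechet_derivative g (at x) v)) (at x)" if "x \<in> S" for x
    using that Suc.prems by (auto intro!: derivative_intros simp: frechet_derivative_works)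
  have "Ck_on k S (\<lambda>x. frechet_derivative (\<lambda>x. f x + g x) (at x) v)" for v
    by (rule Ck_on_cong[OF assms _ Suc.IH]) (use Suc.prems D in \<open>auto simp: frechet_derivative_eqI[OF D]\<close>)
  with D show ?case by (auto simp: differentiable_def)
qed

text \<open>The product rule also contains the undifferentiated factors; \<open>Ck_on_SucD\<close>
  lowers their order to the one that the induction hypothesis expects.\<close>

lemma Ck_on_mult:
  fixes f g :: "'a::real_normed_vector \<Rightarrow> real"
  assumes "open S"
  shows "Ck_on k S f \<Longrightarrow> Ck_on k S g \<Longrightarrow> Ck_on k S (\<lambda>x. f x * g x)"
proof (induction k arbitrary: f g)
  case 0 then show ?case by (auto intro: continuous_intros)
next
  case (Suc k)
  have D: "((\<lambda>x. f x * g x) has_derivative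
      (\<lambda>v. f x * frechet_derivative g (at x) v + frechet_derivative f (at x) v * g x)) (at x)" if "x \<in> S" for x
    using that Suc.prems by (auto intro!: derivative_intros simp: frechet_derivative_works)
  have "Ck_on k S (\<lambda>x. frechet_derivative (\<lambda>x. f x * g x) (at x) v)" for v
  proof (rule Ck_on_cong[OF assms])
    show "Ck_on k S (\<lambda>x. f x * frechet_derivative g (at x) v + frechet_derivative f (at x) v * g x)"
      using Suc.prems Ck_on_SucD by (intro Ck_on_add[OF assms] Suc.IH) auto
  qed (simp add: frechet_derivative_eqI[OF D])
  with D show ?case by (auto simp: differentiable_def)
qed

text \<open>The derivative \<open>- f' / f^2\<close>, written as a product, contains
  \<open>inverse f\<close> for the same \<open>f\<close>; the induction hypothesis covers it, and
  closure under products does the rest.\<close>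

lemma Ck_on_inverse:
  fixes f :: "'a::real_normed_vector \<Rightarrow> real"
  assumes "open S" and nz: "\<And>x. x \<in> S \<Longrightarrow> f x \<noteq> 0"
  shows "Ck_on k S f \<Longrightarrow> Ck_on k S (\<lambda>x. inverse (f x))"
proof (induction k)
  case 0 then show ?case using nz by (auto intro: continuous_intros)
next
  case (Suc k)
  have D: "((\<lambda>x. inverse (f x)) has_derivative
      (\<lambda>v. (-1) * (frechet_derivative f (at x) v * (inverse (f x) * inverse (f x))))) (at x)" if "x \<in> S" for x
    using that Suc.prems nz by (auto intro!: derivative_eq_intros simp: frechet_derivative_works)
  have *: "Ck_on k S (\<lambda>x. inverse (f x))" using Suc.IH[OF Ck_on_SucD[OF Suc.prems]] .
  have "Ck_on k S (\<lambda>x. frechet_derivative (\<lambda>x. inverse (f x)) (at x) v)" for v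
    by (rule Ck_on_cong[OF assms(1) _ Ck_on_mult[OF assms(1) Ck_on_const[of _ _ "-1"] Ck_on_mult[OF assms(1) _ Ck_on_mult[OF assms(1) * *]]]])
      (use Suc.prems D in \<open>auto simp: frechet_derivative_eqI[OF D]\<close>)
  with D show ?case by (auto simp: differentiable_def)
qed

lemma Ck_on_bounded_linear:
  assumes "open S" and L: "bounded_linear L"
  shows "Ck_on k S f \<Longrightarrow> Ck_on k S (\<lambda>x. L (f x))"
proof (induction k arbitrary: f)
  case 0 then show ?case by (auto intro: bounded_linear.continuous_on[OF L])
next
  case (Suc k)
  have D: "((\<lambda>x. L (f x)) has_derivative (\<lambda>v. L (frechet_derivative f (at x) v))) (at x)" if "x \<in> S" for x
    using that Suc.prems by (auto intro!: bounded_linear.has_derivative[OF L] simp: frechet_derivative_works)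
  have "Ck_on k S (\<lambda>x. frechet_derivative (\<lambda>x. L (f x)) (at x) v)" for v
    by (rule Ck_on_cong[OF assms(1) _ Suc.IH]) (use Suc.prems D in \<open>auto simp: frechet_derivative_eqI[OF D]\<close>)
  with D show ?case by (auto simp: differentiable_def)
qed

lemma smooth_on_cong: "open S \<Longrightarrow> (\<And>x. x \<in> S \<Longrightarrow> f x = g x) \<Longrightarrow> smooth_on S f \<Longrightarrow> smooth_on S g"
  unfolding smooth_on_def using Ck_on_cong by blast

lemma smooth_on_const: "smooth_on S (\<lambda>x. c)"
  by (simp add: smooth_on_def Ck_on_const)

lemma smooth_on_add: "open S \<Longrightarrow> smooth_on S f \<Longrightarrow> smooth_on S g \<Longrightarrow> smooth_on S (\<lambda>x. f x + g x)"
  unfolding smooth_on_def using Ck_on_add by blast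

lemma smooth_on_bounded_linear: "open S \<Longrightarrow> bounded_linear L \<Longrightarrow> smooth_on S f \<Longrightarrow> smooth_on S (\<lambda>x. L (f x))"
  unfolding smooth_on_def using Ck_on_bounded_linear by blast

lemma smooth_on_mult:
  "open S \<Longrightarrow> smooth_on S f \<Longrightarrow> smooth_on S g \<Longrightarrow> smooth_on S (\<lambda>x. f x * g x :: real)"
  unfolding smooth_on_def using Ck_on_mult by blast

lemma smooth_on_minus: "open S \<Longrightarrow> smooth_on S f \<Longrightarrow> smooth_on S (\<lambda>x. - f x)"
  by (rule smooth_on_bounded_linear[OF _ bounded_linear_minus[OF bounded_linear_ident]])

lemma smooth_on_diff: "open S \<Longrightarrow> smooth_on S f \<Longrightarrow> smooth_on S g \<Longrightarrow> smooth_on S (\<lambda>x. f x - g x)"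
  using smooth_on_add[OF _ _ smooth_on_minus, of S f g] by simp

lemma smooth_on_divide:
  "open S \<Longrightarrow> smooth_on S f \<Longrightarrow> smooth_on S g \<Longrightarrow> (\<And>x. x \<in> S \<Longrightarrow> g x \<noteq> 0) \<Longrightarrow> smooth_on S (\<lambda>x. f x / g x :: real)"
  unfolding divide_inverse by (rule smooth_on_mult) (auto simp: smooth_on_def intro: Ck_on_inverse)

lemma smooth_on_frechet_derivative: "smooth_on S f \<Longrightarrow> smooth_on S (\<lambda>x. frechet_derivative f (at x) v)"
  unfolding smooth_on_def by (metis Ck_on.simps(2))

lemma smooth_on_differentiable: "smooth_on S f \<Longrightarrow> x \<in> S \<Longrightarrow> f differentiable at x"
  unfolding smooth_on_def by (metis Ck_on.simps(2))

lemma smooth_on_has_derivative: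
  "smooth_on S f \<Longrightarrow> x \<in> S \<Longrightarrow> (f has_derivative frechet_derivative f (at x)) (at x)"
  using smooth_on_differentiable frechet_derivative_works by blast

lemmas smooth_on_intros = smooth_on_const smooth_on_add smooth_on_mult smooth_on_minus smooth_on_diff
  smooth_on_frechet_derivative

section \<open>Linear algebra in dimension three\<close>

lemma linear_axis_expansion:
  fixes f :: "real^'n \<Rightarrow> real"
  assumes "linear f"
  shows "f w = (\<Sum>j\<in>UNIV. w $ j * f (axis j 1))"
proof -
  have "f w = f (\<Sum>j\<in>UNIV. w $ j *s axis j 1)" by (simp add: basis_expansion)
  also have "\<dots> = (\<Sum>j\<in>UNIV. w $ j * f (axis j 1))"
    by (simp add: linear_sum[OF assms] scalar_mult_eq_scaleR linear_cmul[OF assms])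
  finally show ?thesis .
qed

text \<open>The values of the functionals on the standard basis form a matrix \<open>M\<close>.
  Independence makes \<open>M\<close> invertible, the columns of its inverse are the dual basis, and
  the last claim is that its determinant does not vanish.\<close>

lemma independent_functionals_3:
  fixes f1 f2 f3 :: "real^3 \<Rightarrow> real"
  assumes lin: "linear f1" "linear f2" "linear f3"
    and ind: "\<And>a1 a2 a3. (\<And>u. a1 * f1 u + a2 * f2 u + a3 * f3 u = 0) \<Longrightarrow> a1 = 0 \<and> a2 = 0 \<and> a3 = 0"
  obtains e1 e2 e3 where
    "f1 e1 = 1" "f2 e1 = 0" "f3 e1 = 0" "f1 e2 = 0" "f2 e2 = 1" "f3 e2 = 0" "f1 e3 = 0" "f2 e3 = 0" "f3 e3 = 1"
    "f1 (axis 1 1) * (f2 (axis 2 1) * f3 (axis 3 1) - f2 (axis 3 1) * f3 (axis 2 1)) -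
     f1 (axis 2 1) * (f2 (axis 1 1) * f3 (axis 3 1) - f2 (axis 3 1) * f3 (axis 1 1)) +
     f1 (axis 3 1) * (f2 (axis 1 1) * f3 (axis 2 1) - f2 (axis 2 1) * f3 (axis 1 1)) \<noteq> 0"
proof -
  define F where "F i = (if i = (1::3) then f1 else if i = 2 then f2 else f3)" for i
  have F: "F 1 = f1" "F 2 = f2" "F 3 = f3" by (simp_all add: F_def)
  have linF: "linear (F i)" for i by (simp add: F_def lin)
  define M :: "real^3^3" where "M = (\<chi> i j. F i (axis j 1))"
  have Mv: "(M *v x) $ i = F i x" for x i
    using linear_axis_expansion[OF linF, of i x] by (simp add: M_def matrix_vector_mult_def mult.commute)
  \<comment> \<open>A kernel vector of the transpose gives a linear combination of the functionals
    that vanishes on the axis vectors, hence everywhere.\<close>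
  have "a = 0" if "transpose M *v a = 0" for a
  proof -
    have *: "(\<Sum>i\<in>UNIV. a $ i * F i (axis j 1)) = 0" for j
      using arg_cong[OF that, of "\<lambda>w. w $ j"]
      by (simp add: matrix_vector_mult_def transpose_def M_def mult.commute)
    have lin: "linear (\<lambda>u. \<Sum>i\<in>UNIV. a $ i * F i u)"
      using linear_cmul[OF linF]
      by (intro linear_compose_sum ballI linearI) (auto simp: linear_add[OF linF] algebra_simps)
    have "(\<Sum>i\<in>UNIV. a $ i * F i u) = 0" for u
      unfolding linear_axis_expansion[OF lin, of u] by (simp add: *)
    then have "a $ 1 * f1 u + a $ 2 * f2 u + a $ 3 * f3 u = 0" for u
      unfolding sum_3 F .
    from ind[OF this] show "a = 0" by (simp add: vec_eq_iff forall_3)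
  qed
  then have "invertible (transpose M)"
    unfolding invertible_left_inverse matrix_left_invertible_ker by blast
  then have inv: "invertible M" by (metis transpose_invertible transpose_transpose)
  then obtain B where B: "M ** B = mat 1" unfolding invertible_def by blast
  define e where "e j = B *v axis j 1" for j
  have e: "F i (e j) = (if i = j then 1 else 0)" for i j
    unfolding e_def Mv[symmetric] matrix_vector_mul_assoc B by (simp add: axis_def)
  have "det M \<noteq> 0" using inv by (simp add: invertible_det_nz)
  \<comment> \<open>The determinant is expanded in the shape that \<open>wedge12\<close> and
    \<open>wedge11\<close> produce on the three axis vectors.\<close>
  then have "f1 (axis 1 1) * (f2 (axis 2 1) * f3 (axis 3 1) - f2 (axis 3 1) * f3 (axis 2 1)) -
     f1 (axis 2 1) * (f2 (axis 1 1) * f3 (axis 3 1) - f2 (axis 3 1) * f3 (axis 1 1)) +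
     f1 (axis 3 1) * (f2 (axis 1 1) * f3 (axis 2 1) - f2 (axis 2 1) * f3 (axis 1 1)) \<noteq> 0"
    unfolding det_3 M_def by (simp add: F algebra_simps)
  with e[of 1 1] e[of 2 1] e[of 3 1] e[of 1 2] e[of 2 2] e[of 3 2] e[of 1 3] e[of 2 3] e[of 3 3]
  show thesis by (intro that[of "e 1" "e 2" "e 3"]) (simp_all add: F)
qed

section \<open>Charts and forms\<close>

lemma inj_on_chart:
  assumes "chart_on M c"
  shows "inj_on (snd c) (fst c)"
proof -
  have "fst c \<subseteq> topspace M" using assms openin_subset by (auto simp: chart_on_def)
  then have "topspace (subtopology M (fst c)) = fst c" by auto
  then show ?thesis using assms homeomorphic_imp_injective_map unfolding chart_on_def by metis
qed

lemma chart_inv_chart: "chart_on M c \<Longrightarrow> p \<in> fst c \<Longrightarrow> chart_inv c (snd c p) = p"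
  by (simp add: chart_inv_def inv_into_f_f inj_on_chart)

lemma open_transition_dom:
  assumes c: "chart_on M c" and c': "chart_on M c'"
  shows "open (transition_dom c c')"
proof -
  have "openin (subtopology M (fst c)) (fst c \<inter> fst c')"
    using c c' by (auto simp: chart_on_def openin_subtopology)
  then have "openin (top_of_set (chart_image c)) (transition_dom c c')"
    using c homeomorphic_imp_open_map unfolding chart_on_def open_map_def transition_dom_def by blast
  then show ?thesis using c unfolding chart_on_def by (metis openin_open_eq)
qed

lemma transition_dom_subset: "transition_dom c c' \<subseteq> chart_image c"
  by (auto simp: transition_dom_def chart_image_def)

lemma transition_in_chart_image:
  "chart_on M c \<Longrightarrow> x \<in> transition_dom c c' \<Longrightarrow> transition c c' x \<in> chart_image c'"
  by (auto simp: transition_dom_def chart_image_def transition_def chart_inv_chart)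

lemma chart_inv_transition:
  "chart_on M c \<Longrightarrow> chart_on M c' \<Longrightarrow> x \<in> transition_dom c c' \<Longrightarrow>
    chart_inv c' (transition c c' x) = chart_inv c x"
  by (auto simp: transition_dom_def transition_def chart_inv_chart)

lemma smooth_form1_smooth: "smooth_form1 A \<alpha> \<Longrightarrow> c \<in> A \<Longrightarrow> smooth_on (chart_image c) (\<lambda>x. \<alpha> c x u)"
  by (simp add: smooth_form1_def)

lemma smooth_form1_linear: "smooth_form1 A \<alpha> \<Longrightarrow> c \<in> A \<Longrightarrow> x \<in> chart_image c \<Longrightarrow> linear (\<alpha> c x)"
  by (simp add: smooth_form1_def)

lemma smooth_form1_transition:
  "smooth_form1 A \<alpha> \<Longrightarrow> c \<in> A \<Longrightarrow> c' \<in> A \<Longrightarrow> x \<in> transition_dom c c' \<Longrightarrow>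
    \<alpha> c x u = \<alpha> c' (transition c c' x) (frechet_derivative (transition c c') (at x) u)"
  unfolding smooth_form1_def by blast

lemma smooth_form1_has_derivative:
  "smooth_form1 A \<alpha> \<Longrightarrow> c \<in> A \<Longrightarrow> x \<in> chart_image c \<Longrightarrow>
    ((\<lambda>y. \<alpha> c y u) has_derivative frechet_derivative (\<lambda>y. \<alpha> c y u) (at x)) (at x)"
  by (rule smooth_on_has_derivative[OF smooth_form1_smooth])

text \<open>The counterpart of \<open>scale2\<close> for 1-forms. Through it, both
  \<open>lincomb1\<close> and the form \<open>\<eta>\<close> of the pair
  \<open>(\<omega>1, \<omega>3)\<close> inherit smoothness from closure under sums and
  multiples.\<close>

definition scale1 :: "('a \<Rightarrow> real) \<Rightarrow> 'a form1 \<Rightarrow> 'a form1" where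
  "scale1 f \<alpha> c x u = f (chart_inv c x) * \<alpha> c x u"

lemma lincomb1_eq: "lincomb1 l1 \<alpha>1 l2 \<alpha>2 = scale1 (\<lambda>_. l1) \<alpha>1 + scale1 (\<lambda>_. l2) \<alpha>2"
  by (simp add: fun_eq_iff lincomb1_def scale1_def)

section \<open>Consequences of the structure equations\<close>

lemma gen_finsler_smooth:
  assumes "gen_finsler A I J K \<omega>1 \<omega>2 \<omega>3"
  shows "smooth_form1 A \<omega>1" "smooth_form1 A \<omega>2" "smooth_form1 A \<omega>3"
    "smooth_fun A I" "smooth_fun A J" "smooth_fun A K"
  using assms by (auto simp: gen_finsler_def coframing_def)

lemma gen_finsler_ext_d:
  assumes "gen_finsler A I J K \<omega>1 \<omega>2 \<omega>3" "c \<in> A" "x \<in> chart_image c"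
  shows "ext_d \<omega>1 c x u v = - (I (chart_inv c x) * (\<omega>1 \<^bold>\<and> \<omega>3) c x u v) + (\<omega>2 \<^bold>\<and> \<omega>3) c x u v"
    "ext_d \<omega>2 c x u v = - (\<omega>1 \<^bold>\<and> \<omega>3) c x u v"
    "ext_d \<omega>3 c x u v = K (chart_inv c x) * (\<omega>1 \<^bold>\<and> \<omega>2) c x u v - J (chart_inv c x) * (\<omega>1 \<^bold>\<and> \<omega>3) c x u v"
  using assms by (simp_all add: gen_finsler_def form_eq_def scale2_def)

text \<open>In each product only the term of the structure equation that involves the two other
  coframe forms survives; reordering its factors fixes the sign. All later comparisons read their
  coefficients from this table.\<close>

lemma gen_finsler_wedge_ext_d:
  assumes "gen_finsler A I J K \<omega>1 \<omega>2 \<omega>3" "c \<in> A" "x \<in> chart_image c"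
  defines "vol \<equiv> (\<omega>1 \<^bold>\<and>\<^sub>2 \<omega>2 \<^bold>\<and> \<omega>3) c x"
  shows "(\<omega>1 \<^bold>\<and>\<^sub>2 ext_d \<omega>1) c x u v w = vol u v w"
    "(\<omega>1 \<^bold>\<and>\<^sub>2 ext_d \<omega>2) c x u v w = 0"
    "(\<omega>1 \<^bold>\<and>\<^sub>2 ext_d \<omega>3) c x u v w = 0"
    "(\<omega>2 \<^bold>\<and>\<^sub>2 ext_d \<omega>1) c x u v w = I (chart_inv c x) * vol u v w"
    "(\<omega>2 \<^bold>\<and>\<^sub>2 ext_d \<omega>2) c x u v w = vol u v w"
    "(\<omega>2 \<^bold>\<and>\<^sub>2 ext_d \<omega>3) c x u v w = J (chart_inv c x) * vol u v w"
    "(\<omega>3 \<^bold>\<and>\<^sub>2 ext_d \<omega>1) c x u v w = 0"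
    "(\<omega>3 \<^bold>\<and>\<^sub>2 ext_d \<omega>2) c x u v w = 0"
    "(\<omega>3 \<^bold>\<and>\<^sub>2 ext_d \<omega>3) c x u v w = K (chart_inv c x) * vol u v w"
  unfolding vol_def wedge12_def gen_finsler_ext_d[OF assms(1-3)] wedge11_def
  by (simp_all add: algebra_simps)

text \<open>The dual frame is chosen at one point only. The last claim instead uses the axis
  vectors, which are constant in the chart, so the nonzero number depends smoothly on the point and
  can serve as a denominator.\<close>

lemma coframing_frame:
  assumes "coframing A \<omega>1 \<omega>2 \<omega>3" "c \<in> A" "x \<in> chart_image c"
  obtains e1 e2 e3 where
    "\<omega>1 c x e1 = 1" "\<omega>2 c x e1 = 0" "\<omega>3 c x e1 = 0"
    "\<omega>1 c x e2 = 0" "\<omega>2 c x e2 = 1" "\<omega>3 c x e2 = 0"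
    "\<omega>1 c x e3 = 0" "\<omega>2 c x e3 = 0" "\<omega>3 c x e3 = 1"
    "(\<omega>1 \<^bold>\<and>\<^sub>2 \<omega>2 \<^bold>\<and> \<omega>3) c x (axis 1 1) (axis 2 1) (axis 3 1) \<noteq> 0"
proof -
  have lin: "linear (\<omega>1 c x)" "linear (\<omega>2 c x)" "linear (\<omega>3 c x)"
    using assms by (auto simp: coframing_def smooth_form1_linear)
  show thesis
  proof (rule independent_functionals_3[OF lin], goal_cases)
    case (1 a1 a2 a3)
    then show ?case using assms unfolding coframing_def by blast
  next
    case (2 e1 e2 e3)
    then show ?case by (intro that[of e1 e2 e3]) (simp_all add: wedge12_def wedge11_def)
  qed
qed

lemma gen_finsler_vol_nonzero:
  assumes "gen_finsler A I J K \<omega>1 \<omega>2 \<omega>3" "c \<in> A" "x \<in> chart_image c"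
  shows "(\<omega>1 \<^bold>\<and>\<^sub>2 \<omega>2 \<^bold>\<and> \<omega>3) c x (axis 1 1) (axis 2 1) (axis 3 1) \<noteq> 0"
  using coframing_frame[OF _ assms(2,3)] assms(1) unfolding gen_finsler_def by metis

section \<open>Forms and functions on a manifold with a smooth atlas\<close>

context
  fixes M :: "'a topology" and A :: "'a chart set"
  assumes atlas: "smooth_atlas M A"
begin

lemma chart_on: "c \<in> A \<Longrightarrow> chart_on M c"
  using atlas by (simp add: smooth_atlas_def)

lemma open_chart_image: "c \<in> A \<Longrightarrow> open (chart_image c)"
  using chart_on chart_on_def by blast

lemma smooth_transition: "c \<in> A \<Longrightarrow> c' \<in> A \<Longrightarrow> smooth_on (transition_dom c c') (transition c c')"
  using atlas by (simp add: smooth_atlas_def)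

lemma topspace_chartE:
  assumes "p \<in> topspace M"
  obtains c where "c \<in> A" "p \<in> fst c" "snd c p \<in> chart_image c" "chart_inv c (snd c p) = p"
proof -
  obtain c where c: "c \<in> A" "p \<in> fst c"
    using assms atlas unfolding smooth_atlas_def by blast
  then show thesis
    using chart_inv_chart[OF chart_on] by (intro that[of c]) (auto simp: chart_image_def)
qed

lemma chart_inv_in_topspace:
  assumes "c \<in> A" "x \<in> chart_image c"
  shows "chart_inv c x \<in> topspace M"
proof -
  obtain p where "p \<in> fst c" "x = snd c p" using assms by (auto simp: chart_image_def)
  then show ?thesis
    using assms(1) atlas chart_inv_chart[OF chart_on] unfolding smooth_atlas_def by auto
qed

text \<open>The charts cover the manifold, so conditions on points and conditions on chart images
  can be exchanged.\<close>

lemma topspace_all_iff: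
  "(\<forall>p\<in>topspace M. P p) \<longleftrightarrow> (\<forall>c\<in>A. \<forall>x\<in>chart_image c. P (chart_inv c x))"
  using chart_inv_in_topspace topspace_chartE by metis

lemma smooth_form1_add:
  assumes "smooth_form1 A \<alpha>" "smooth_form1 A \<beta>"
  shows "smooth_form1 A (\<alpha> + \<beta>)"
proof -
  have "linear (\<lambda>u. \<alpha> c x u + \<beta> c x u)" if "c \<in> A" "x \<in> chart_image c" for c x
    using assms that by (intro linear_compose_add) (auto simp: smooth_form1_linear)
  moreover have "smooth_on (chart_image c) (\<lambda>x. \<alpha> c x u + \<beta> c x u)" if "c \<in> A" for c u
    using assms that by (intro smooth_on_add open_chart_image) (auto simp: smooth_form1_smooth)
  ultimately show ?thesis
    unfolding smooth_form1_def
    by (auto simp: plus_fun_def smooth_form1_transition[OF assms(1)] smooth_form1_transition[OF assms(2)])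
qed

lemma smooth_form1_scale1:
  assumes f: "smooth_fun A f" and \<alpha>: "smooth_form1 A \<alpha>"
  shows "smooth_form1 A (scale1 f \<alpha>)"
proof -
  have "linear (\<lambda>u. f (chart_inv c x) * \<alpha> c x u)" if "c \<in> A" "x \<in> chart_image c" for c x
    using linear_compose_scale_right[OF smooth_form1_linear[OF \<alpha> that], of "f (chart_inv c x)"] by simp
  moreover have "smooth_on (chart_image c) (\<lambda>x. f (chart_inv c x) * \<alpha> c x u)" if "c \<in> A" for c u
    using assms that by (intro smooth_on_mult open_chart_image) (auto simp: smooth_form1_smooth smooth_fun_def o_def)
  ultimately show ?thesis
    unfolding smooth_form1_def
    by (auto simp: scale1_def[abs_def] chart_inv_transition[OF chart_on chart_on] smooth_form1_transition[OF \<alpha>])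
qed

lemma smooth_fun_const: "smooth_fun A (\<lambda>_. k)"
  by (simp add: smooth_fun_def o_def smooth_on_const)

lemma smooth_form1_lincomb1:
  "smooth_form1 A \<alpha>1 \<Longrightarrow> smooth_form1 A \<alpha>2 \<Longrightarrow> smooth_form1 A (lincomb1 l1 \<alpha>1 l2 \<alpha>2)"
  unfolding lincomb1_eq by (intro smooth_form1_add smooth_form1_scale1 smooth_fun_const)

section \<open>The exterior derivative\<close>

lemma ext_d_lincomb1:
  assumes "smooth_form1 A \<alpha>1" "smooth_form1 A \<alpha>2" "c \<in> A" "x \<in> chart_image c"
  shows "ext_d (lincomb1 l1 \<alpha>1 l2 \<alpha>2) c x u v = l1 * ext_d \<alpha>1 c x u v + l2 * ext_d \<alpha>2 c x u v"
proof -
  have "frechet_derivative (\<lambda>y. lincomb1 l1 \<alpha>1 l2 \<alpha>2 c y v) (at x) =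
     (\<lambda>u. l1 * frechet_derivative (\<lambda>y. \<alpha>1 c y v) (at x) u + l2 * frechet_derivative (\<lambda>y. \<alpha>2 c y v) (at x) u)" for v
    unfolding lincomb1_def
    by (intro frechet_derivative_eqI derivative_intros smooth_form1_has_derivative[OF assms(1,3,4)]
      smooth_form1_has_derivative[OF assms(2,3,4)])
  then show ?thesis by (simp add: ext_d_def algebra_simps)
qed

text \<open>This is the identity \<open>d(\<alpha> \<and> \<beta>) = 0\<close>, which needs no exterior derivative of 2-forms
  when written as \<open>d\<alpha> \<and> \<beta> = \<alpha> \<and> d\<beta>\<close>.\<close>

lemma exact_wedge11:
  assumes \<omega>: "smooth_form1 A \<omega>" and \<alpha>: "smooth_form1 A \<alpha>" and \<beta>: "smooth_form1 A \<beta>"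
    and eq: "form_eq A (ext_d \<omega>) (\<alpha> \<^bold>\<and> \<beta>)"
  shows "form_eq A (\<beta> \<^bold>\<and>\<^sub>2 ext_d \<alpha>) (\<alpha> \<^bold>\<and>\<^sub>2 ext_d \<beta>)"
  unfolding form_eq_def
proof (intro ballI ext)
  fix c x u v w assume c: "c \<in> A" and x: "x \<in> chart_image c"
  note S = open_chart_image[OF c]
  \<comment> \<open>\<open>H v u w\<close> differentiates the component \<open>\<omega>(v)\<close>
    first along \<open>u\<close> and then along \<open>w\<close>; \<open>sym\<close> exchanges the
    two directions.\<close>
  define H where "H v u w = frechet_derivative (\<lambda>y. frechet_derivative (\<lambda>z. \<omega> c z v) (at y) u) (at x) w" for u v w
  have sym: "H v u w = H v w u" for u v w
    unfolding H_def using smooth_form1_smooth[OF \<omega> c] S x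
    by (intro symmetric_second_frechet_derivative[of "chart_image c"]) (auto simp: smooth_on_def)
  define a where "a v u = frechet_derivative (\<lambda>y. \<alpha> c y v) (at x) u" for u v
  define b where "b v u = frechet_derivative (\<lambda>y. \<beta> c y v) (at x) u" for u v
  have "H v u w - H u v w = (\<alpha> c x u * b v w + a u w * \<beta> c x v) - (\<alpha> c x v * b u w + a v w * \<beta> c x u)" for u v w
  proof -
    have 1: "((\<lambda>y. ext_d \<omega> c y u v) has_derivative (\<lambda>w. H v u w - H u v w)) (at x)"
      unfolding ext_d_def H_def
      using smooth_on_has_derivative[OF smooth_on_frechet_derivative[OF smooth_form1_smooth[OF \<omega> c]] x]
      by (intro derivative_intros)
    have 2: "((\<lambda>y. (\<alpha> \<^bold>\<and> \<beta>) c y u v) has_derivative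
      (\<lambda>w. (\<alpha> c x u * b v w + a u w * \<beta> c x v) - (\<alpha> c x v * b u w + a v w * \<beta> c x u))) (at x)"
      unfolding wedge11_def a_def b_def
      by (intro derivative_intros smooth_form1_has_derivative[OF \<alpha> c x] smooth_form1_has_derivative[OF \<beta> c x])
    have "((\<lambda>y. ext_d \<omega> c y u v) has_derivative
      (\<lambda>w. (\<alpha> c x u * b v w + a u w * \<beta> c x v) - (\<alpha> c x v * b u w + a v w * \<beta> c x u))) (at x)"
      using 2 S x by (rule has_derivative_transform_within_open) (use eq c in \<open>auto simp: form_eq_def\<close>)
    from has_derivative_unique[OF 1 this] show ?thesis by meson
  qed
  \<comment> \<open>The cyclic sum over \<open>u\<close>, \<open>v\<close>, \<open>w\<close> cancels
    all second derivatives on the left by symmetry; on the right it leaves the difference of the two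
    3-forms.\<close>
  from this[where u = u and v = v and w = w] this[where u = v and v = w and w = u] this[where u = w and v = u and w = v]
    sym[where v = u and u = v and w = w] sym[where v = v and u = u and w = w] sym[where v = w and u = u and w = v]
  show "(\<beta> \<^bold>\<and>\<^sub>2 ext_d \<alpha>) c x u v w = (\<alpha> \<^bold>\<and>\<^sub>2 ext_d \<beta>) c x u v w"
    unfolding wedge12_def ext_d_def a_def[symmetric] b_def[symmetric] by (simp add: algebra_simps)
qed

text \<open>This is the naturality of \<open>d\<close> under pullback. Differentiating the
  transformation law of \<open>\<alpha>\<close> yields the expected term plus second derivatives of
  \<open>\<tau>\<close>, and these cancel on antisymmetrization.\<close>

lemma ext_d_transition:
  assumes \<alpha>: "smooth_form1 A \<alpha>" and c: "c \<in> A" and c': "c' \<in> A" and x: "x \<in> transition_dom c c'"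
  defines "\<tau> \<equiv> transition c c'"
  shows "ext_d \<alpha> c x u v =
    ext_d \<alpha> c' (\<tau> x) (frechet_derivative \<tau> (at x) u) (frechet_derivative \<tau> (at x) v)"
proof -
  define T where "T = transition_dom c c'"
  have T: "open T" "x \<in> T"
    using open_transition_dom[OF chart_on[OF c] chart_on[OF c']] x by (auto simp: T_def)
  have \<tau>x: "\<tau> x \<in> chart_image c'"
    using transition_in_chart_image[OF chart_on[OF c] x] by (simp add: \<tau>_def)
  have sm: "smooth_on T \<tau>" using smooth_transition[OF c c'] by (simp add: T_def \<tau>_def)
  define t where "t j = (\<lambda>y. \<tau> y $ j)" for j
  have smt: "smooth_on T (t j)" for j
    unfolding t_def using smooth_on_bounded_linear[OF T(1) bounded_linear_vec_nth sm] .
  have Dt: "frechet_derivative (t j) (at y) w = frechet_derivative \<tau> (at y) w $ j" if "y \<in> T" for y j w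
  proof -
    have "(t j has_derivative (\<lambda>w. frechet_derivative \<tau> (at y) w $ j)) (at y)"
      unfolding t_def by (rule bounded_linear.has_derivative[OF bounded_linear_vec_nth smooth_on_has_derivative[OF sm that]])
    from frechet_derivative_eqI[OF this] show ?thesis by (rule fun_cong)
  qed
  \<comment> \<open>Splitting \<open>\<alpha>\<close> into its components \<open>B j\<close>
    separates the dependence on the point from that on the vector, which itself varies with the
    point through the derivative of \<open>\<tau>\<close>.\<close>
  define B where "B j z = \<alpha> c' z (axis j 1)" for j z
  have B: "\<alpha> c' z w = (\<Sum>j\<in>UNIV. w $ j * B j z)" if "z \<in> chart_image c'" for z w
    unfolding B_def by (rule linear_axis_expansion[OF smooth_form1_linear[OF \<alpha> c' that]])
  have DB: "(B j has_derivative frechet_derivative (B j) (at (\<tau> x))) (at (\<tau> x))" for j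
    unfolding B_def[abs_def] by (rule smooth_form1_has_derivative[OF \<alpha> c' \<tau>x])
  have up: "frechet_derivative (\<lambda>z. \<alpha> c' z w) (at (\<tau> x)) = (\<lambda>u. \<Sum>j\<in>UNIV. w $ j * frechet_derivative (B j) (at (\<tau> x)) u)" for w
  proof (rule frechet_derivative_eqI)
    have "((\<lambda>z. \<Sum>j\<in>UNIV. w $ j * B j z) has_derivative (\<lambda>u. \<Sum>j\<in>UNIV. w $ j * frechet_derivative (B j) (at (\<tau> x)) u)) (at (\<tau> x))"
      by (intro derivative_intros DB)
    then show "((\<lambda>z. \<alpha> c' z w) has_derivative (\<lambda>u. \<Sum>j\<in>UNIV. w $ j * frechet_derivative (B j) (at (\<tau> x)) u)) (at (\<tau> x))"
      using open_chart_image[OF c'] \<tau>x by (rule has_derivative_transform_within_open) (simp add: B)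
  qed
  have down: "frechet_derivative (\<lambda>y. \<alpha> c y v) (at x) = (\<lambda>u. \<Sum>j\<in>UNIV.
      frechet_derivative (t j) (at x) v * frechet_derivative (B j) (at (\<tau> x)) (frechet_derivative \<tau> (at x) u) +
      frechet_derivative (\<lambda>y. frechet_derivative (t j) (at y) v) (at x) u * B j (\<tau> x))" for v
  proof (rule frechet_derivative_eqI)
    have "((\<lambda>y. \<Sum>j\<in>UNIV. frechet_derivative (t j) (at y) v * B j (\<tau> y)) has_derivative (\<lambda>u. \<Sum>j\<in>UNIV.
      frechet_derivative (t j) (at x) v * frechet_derivative (B j) (at (\<tau> x)) (frechet_derivative \<tau> (at x) u) +
      frechet_derivative (\<lambda>y. frechet_derivative (t j) (at y) v) (at x) u * B j (\<tau> x))) (at x)"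
      by (intro has_derivative_sum has_derivative_mult has_derivative_compose[where f = \<tau>, OF _ DB]
        smooth_on_has_derivative[OF sm T(2)] smooth_on_has_derivative[OF smooth_on_frechet_derivative[OF smt] T(2)])
    then show "((\<lambda>y. \<alpha> c y v) has_derivative (\<lambda>u. \<Sum>j\<in>UNIV.
      frechet_derivative (t j) (at x) v * frechet_derivative (B j) (at (\<tau> x)) (frechet_derivative \<tau> (at x) u) +
      frechet_derivative (\<lambda>y. frechet_derivative (t j) (at y) v) (at x) u * B j (\<tau> x))) (at x)"
      using T
    proof (rule has_derivative_transform_within_open)
      fix y assume y: "y \<in> T"
      have "\<tau> y \<in> chart_image c'"
        using transition_in_chart_image[OF chart_on[OF c]] y by (simp add: \<tau>_def T_def)
      then show "(\<Sum>j\<in>UNIV. frechet_derivative (t j) (at y) v * B j (\<tau> y)) = \<alpha> c y v"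
        using smooth_form1_transition[OF \<alpha> c c'] y by (simp add: B Dt T_def \<tau>_def)
    qed
  qed
  have "frechet_derivative (\<lambda>y. frechet_derivative (t j) (at y) v) (at x) u =
      frechet_derivative (\<lambda>y. frechet_derivative (t j) (at y) u) (at x) v" for j
    using smt[of j] T by (intro symmetric_second_frechet_derivative[of T]) (auto simp: smooth_on_def)
  then show ?thesis
    unfolding ext_d_def up down by (simp add: Dt[OF T(2)] sum.distrib)
qed

section \<open>Tautness as equations, and gluing of functions\<close>

text \<open>The 3-form \<open>Q l1 l2\<close> is a quadratic form in \<open>(l1, l2)\<close>. It is
  constant on the unit circle exactly when its square terms have equal coefficients and its mixed
  term vanishes.\<close>

lemma taut_contact_circle_iff:
  "taut_contact_circle A \<alpha>1 \<alpha>2 \<longleftrightarrow> smooth_form1 A \<alpha>1 \<and> smooth_form1 A \<alpha>2 \<and>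
     nowhere_zero A (\<alpha>1 \<^bold>\<and>\<^sub>2 ext_d \<alpha>1) \<and> form_eq A (\<alpha>1 \<^bold>\<and>\<^sub>2 ext_d \<alpha>1) (\<alpha>2 \<^bold>\<and>\<^sub>2 ext_d \<alpha>2) \<and>
     form_eq A (\<alpha>1 \<^bold>\<and>\<^sub>2 ext_d \<alpha>2 + \<alpha>2 \<^bold>\<and>\<^sub>2 ext_d \<alpha>1) 0"
  (is "?L \<longleftrightarrow> ?R")
proof -
  define Q where "Q l1 l2 = lincomb1 l1 \<alpha>1 l2 \<alpha>2 \<^bold>\<and>\<^sub>2 ext_d (lincomb1 l1 \<alpha>1 l2 \<alpha>2)" for l1 l2
  have Q: "Q l1 l2 c x u v w = l1\<^sup>2 * (\<alpha>1 \<^bold>\<and>\<^sub>2 ext_d \<alpha>1) c x u v w + l2\<^sup>2 * (\<alpha>2 \<^bold>\<and>\<^sub>2 ext_d \<alpha>2) c x u v w +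
      l1 * l2 * (\<alpha>1 \<^bold>\<and>\<^sub>2 ext_d \<alpha>2 + \<alpha>2 \<^bold>\<and>\<^sub>2 ext_d \<alpha>1) c x u v w"
    if "smooth_form1 A \<alpha>1" "smooth_form1 A \<alpha>2" "c \<in> A" "x \<in> chart_image c" for l1 l2 c x u v w
    unfolding Q_def wedge12_def plus_fun_apply ext_d_lincomb1[OF that]
    by (simp add: lincomb1_def algebra_simps power2_eq_square)
  show ?thesis
  proof
    assume L: ?L
    then have sm: "smooth_form1 A \<alpha>1" "smooth_form1 A \<alpha>2" and nz: "nowhere_zero A (\<alpha>1 \<^bold>\<and>\<^sub>2 ext_d \<alpha>1)"
      by (auto simp: taut_contact_circle_def contact_circle_def contact_form_def)
    have eq: "Q l1 l2 c x = Q m1 m2 c x"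
      if "c \<in> A" "x \<in> chart_image c" "l1\<^sup>2 + l2\<^sup>2 = 1" "m1\<^sup>2 + m2\<^sup>2 = 1" for c x l1 l2 m1 m2
      using L that unfolding taut_contact_circle_def Q_def form_eq_def by blast
    have *: "(\<alpha>1 \<^bold>\<and>\<^sub>2 ext_d \<alpha>1) c x u v w = (\<alpha>2 \<^bold>\<and>\<^sub>2 ext_d \<alpha>2) c x u v w \<and>
      (\<alpha>1 \<^bold>\<and>\<^sub>2 ext_d \<alpha>2 + \<alpha>2 \<^bold>\<and>\<^sub>2 ext_d \<alpha>1) c x u v w = 0" if cx: "c \<in> A" "x \<in> chart_image c" for c x u v w
    proof -
      have 1: "Q 1 0 c x u v w = Q 0 1 c x u v w" using eq[OF cx, of 1 0 0 1] by simp
      \<comment> \<open>With the square coefficients equal, one point of the circle off both axes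
        suffices to kill the mixed term; \<open>(3/5, 4/5)\<close> is a rational one.\<close>
      have 2: "Q 1 0 c x u v w = Q (3/5) (4/5) c x u v w"
        using eq[OF cx, of 1 0 "3/5" "4/5"] by (simp add: power2_eq_square)
      show ?thesis using 1 2 unfolding Q[OF sm cx] by (simp add: power2_eq_square)
    qed
    show ?R unfolding form_eq_def using sm nz * by (intro conjI ballI ext) simp_all
  next
    assume R: ?R
    then have sm: "smooth_form1 A \<alpha>1" "smooth_form1 A \<alpha>2" by auto
    have *: "Q l1 l2 c x = (\<alpha>1 \<^bold>\<and>\<^sub>2 ext_d \<alpha>1) c x"
      if cx: "c \<in> A" "x \<in> chart_image c" and l: "l1\<^sup>2 + l2\<^sup>2 = 1" for l1 l2 c x
    proof (intro ext)
      fix u v w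
      have "Q l1 l2 c x u v w = (l1\<^sup>2 + l2\<^sup>2) * (\<alpha>1 \<^bold>\<and>\<^sub>2 ext_d \<alpha>1) c x u v w"
        using R cx unfolding Q[OF sm cx] form_eq_def by (simp add: algebra_simps)
      then show "Q l1 l2 c x u v w = (\<alpha>1 \<^bold>\<and>\<^sub>2 ext_d \<alpha>1) c x u v w" using l by simp
    qed
    have "contact_form A \<alpha>1" "contact_form A \<alpha>2"
      using R by (auto simp: contact_form_def nowhere_zero_def form_eq_def)
    moreover have "contact_form A (lincomb1 l1 \<alpha>1 l2 \<alpha>2)" if "l1\<^sup>2 + l2\<^sup>2 = 1" for l1 l2
      using R *[OF _ _ that] smooth_form1_lincomb1[OF sm]
      unfolding contact_form_def nowhere_zero_def Q_def by simp
    ultimately show ?L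
      using * unfolding taut_contact_circle_def contact_circle_def form_eq_def Q_def by simp
  qed
qed

text \<open>The value at a point is read off in an arbitrarily chosen chart around it; compatibility
  makes the choice irrelevant, and in every chart the resulting function is the given smooth
  one.\<close>

lemma glue_smooth_fun:
  assumes smooth: "\<And>c. c \<in> A \<Longrightarrow> smooth_on (chart_image c) (k c)"
    and compat: "\<And>c c' x. c \<in> A \<Longrightarrow> c' \<in> A \<Longrightarrow> x \<in> transition_dom c c' \<Longrightarrow> k c x = k c' (transition c c' x)"
  shows "\<exists>\<kappa>. smooth_fun A \<kappa> \<and> (\<forall>c\<in>A. \<forall>x\<in>chart_image c. \<kappa> (chart_inv c x) = k c x)"
proof -
  define ch where "ch p = (SOME c. c \<in> A \<and> p \<in> fst c)" for p
  define \<kappa> where "\<kappa> p = k (ch p) (snd (ch p) p)" for p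
  have \<kappa>: "\<kappa> (chart_inv c x) = k c x" if c: "c \<in> A" and x: "x \<in> chart_image c" for c x
  proof -
    obtain p where p: "p \<in> fst c" "x = snd c p" using x by (auto simp: chart_image_def)
    have inv: "chart_inv c x = p" using chart_inv_chart[OF chart_on[OF c] p(1)] p(2) by simp
    have ch: "ch p \<in> A \<and> p \<in> fst (ch p)" unfolding ch_def by (rule someI[of _ c]) (use c p in simp)
    have "x \<in> transition_dom c (ch p)" using p ch by (auto simp: transition_dom_def)
    moreover have "transition c (ch p) x = snd (ch p) p" by (simp add: transition_def inv)
    ultimately show ?thesis using compat[OF c, of "ch p" x] ch by (simp add: inv \<kappa>_def)
  qed
  have "smooth_fun A \<kappa>"
    unfolding smooth_fun_def o_def
    using smooth_on_cong[OF open_chart_image _ smooth] \<kappa> by auto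
  with \<kappa> show ?thesis by blast
qed

section \<open>Coefficients with respect to the volume form\<close>

text \<open>The volume form vanishes nowhere, so equations between its multiples are equations
  between the coefficients. For all three pairs of coframe forms the first coefficient is 1, which
  leaves only \<open>q\<close> and \<open>r\<close>.\<close>

lemma taut_contact_circle_iff_coeffs:
  assumes G: "gen_finsler A I J K \<omega>1 \<omega>2 \<omega>3" and sm: "smooth_form1 A \<alpha>1" "smooth_form1 A \<alpha>2"
    and c11: "\<And>c x u v w. c \<in> A \<Longrightarrow> x \<in> chart_image c \<Longrightarrow>
      (\<alpha>1 \<^bold>\<and>\<^sub>2 ext_d \<alpha>1) c x u v w = (\<omega>1 \<^bold>\<and>\<^sub>2 \<omega>2 \<^bold>\<and> \<omega>3) c x u v w"
    and c22: "\<And>c x u v w. c \<in> A \<Longrightarrow> x \<in> chart_image c \<Longrightarrow>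
      (\<alpha>2 \<^bold>\<and>\<^sub>2 ext_d \<alpha>2) c x u v w = q (chart_inv c x) * (\<omega>1 \<^bold>\<and>\<^sub>2 \<omega>2 \<^bold>\<and> \<omega>3) c x u v w"
    and c12: "\<And>c x u v w. c \<in> A \<Longrightarrow> x \<in> chart_image c \<Longrightarrow>
      (\<alpha>1 \<^bold>\<and>\<^sub>2 ext_d \<alpha>2 + \<alpha>2 \<^bold>\<and>\<^sub>2 ext_d \<alpha>1) c x u v w = r (chart_inv c x) * (\<omega>1 \<^bold>\<and>\<^sub>2 \<omega>2 \<^bold>\<and> \<omega>3) c x u v w"
  shows "taut_contact_circle A \<alpha>1 \<alpha>2 \<longleftrightarrow> (\<forall>p\<in>topspace M. q p = 1 \<and> r p = 0)"
proof -
  define b1 b2 b3 :: "real^3" where b: "b1 = axis 1 1" "b2 = axis 2 1" "b3 = axis 3 1"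
  have nz: "(\<omega>1 \<^bold>\<and>\<^sub>2 \<omega>2 \<^bold>\<and> \<omega>3) c x b1 b2 b3 \<noteq> 0" if "c \<in> A" "x \<in> chart_image c" for c x
    using gen_finsler_vol_nonzero[OF G that] by (simp add: b)
  have 1: "nowhere_zero A (\<alpha>1 \<^bold>\<and>\<^sub>2 ext_d \<alpha>1)"
    unfolding nowhere_zero_def using nz c11 by (metis zero_fun_apply)
  have 2: "(\<alpha>1 \<^bold>\<and>\<^sub>2 ext_d \<alpha>1) c x = (\<alpha>2 \<^bold>\<and>\<^sub>2 ext_d \<alpha>2) c x \<longleftrightarrow> q (chart_inv c x) = 1"
    if cx: "c \<in> A" "x \<in> chart_image c" for c x
  proof
    assume "(\<alpha>1 \<^bold>\<and>\<^sub>2 ext_d \<alpha>1) c x = (\<alpha>2 \<^bold>\<and>\<^sub>2 ext_d \<alpha>2) c x"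
    then show "q (chart_inv c x) = 1" using c11[OF cx, of b1 b2 b3] c22[OF cx, of b1 b2 b3] nz[OF cx] by simp
  qed (simp add: fun_eq_iff c11[OF cx] c22[OF cx])
  have 3: "(\<alpha>1 \<^bold>\<and>\<^sub>2 ext_d \<alpha>2 + \<alpha>2 \<^bold>\<and>\<^sub>2 ext_d \<alpha>1) c x = 0 c x \<longleftrightarrow> r (chart_inv c x) = 0"
    if cx: "c \<in> A" "x \<in> chart_image c" for c x
  proof
    assume "(\<alpha>1 \<^bold>\<and>\<^sub>2 ext_d \<alpha>2 + \<alpha>2 \<^bold>\<and>\<^sub>2 ext_d \<alpha>1) c x = 0 c x"
    then have "(\<alpha>1 \<^bold>\<and>\<^sub>2 ext_d \<alpha>2 + \<alpha>2 \<^bold>\<and>\<^sub>2 ext_d \<alpha>1) c x b1 b2 b3 = 0" by simp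
    then show "r (chart_inv c x) = 0" unfolding c12[OF cx] using nz[OF cx] by simp
  next
    assume r: "r (chart_inv c x) = 0"
    show "(\<alpha>1 \<^bold>\<and>\<^sub>2 ext_d \<alpha>2 + \<alpha>2 \<^bold>\<and>\<^sub>2 ext_d \<alpha>1) c x = 0 c x"
      by (intro ext) (simp only: c12[OF cx] r zero_fun_apply mult_zero_left)
  qed
  show ?thesis
    unfolding taut_contact_circle_iff topspace_all_iff form_eq_def
    using sm 1 2 3 by auto
qed

lemma form_eq_coeff_vol:
  assumes G: "gen_finsler A I J K \<omega>1 \<omega>2 \<omega>3"
    and eq: "form_eq A \<beta> \<gamma>"
    and b: "\<And>c x u v w. c \<in> A \<Longrightarrow> x \<in> chart_image c \<Longrightarrow>
      \<beta> c x u v w = f (chart_inv c x) * (\<omega>1 \<^bold>\<and>\<^sub>2 \<omega>2 \<^bold>\<and> \<omega>3) c x u v w"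
    and g: "\<And>c x u v w. c \<in> A \<Longrightarrow> x \<in> chart_image c \<Longrightarrow>
      \<gamma> c x u v w = g (chart_inv c x) * (\<omega>1 \<^bold>\<and>\<^sub>2 \<omega>2 \<^bold>\<and> \<omega>3) c x u v w"
  shows "\<forall>p\<in>topspace M. f p = g p"
  unfolding topspace_all_iff
proof (intro ballI)
  fix c x assume cx: "c \<in> A" "x \<in> chart_image c"
  have "\<beta> c x (axis 1 1) (axis 2 1) (axis 3 1) = \<gamma> c x (axis 1 1) (axis 2 1) (axis 3 1)"
    using eq cx by (simp add: form_eq_def)
  then show "f (chart_inv c x) = g (chart_inv c x)"
    unfolding b[OF cx] g[OF cx] using gen_finsler_vol_nonzero[OF G cx] by simp
qed

section \<open>Cartan structures obtained from closedness\<close>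

lemma gen_finsler_K_cartan_coframe:
  assumes G: "gen_finsler A I J K \<omega>1 \<omega>2 \<omega>3" and I: "\<forall>p\<in>topspace M. I p = 0"
  shows "K_cartan_coframe A K \<omega>1 \<omega>2 \<omega>3"
proof -
  note sm = gen_finsler_smooth[OF G] and W = gen_finsler_wedge_ext_d[OF G]
  note I' = I[unfolded topspace_all_iff, rule_format]
  have d1: "form_eq A (ext_d \<omega>1) (\<omega>2 \<^bold>\<and> \<omega>3)"
    unfolding form_eq_def using I' by (intro ballI ext) (simp add: gen_finsler_ext_d[OF G])
  \<comment> \<open>Closedness of \<open>\<omega>2 \<and> \<omega>3\<close> reads
    \<open>\<omega>3 \<and> d\<omega>2 = \<omega>2 \<and> d\<omega>3\<close>; the coefficients are 0
    on the left and \<open>J\<close> on the right.\<close>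
  have J: "\<forall>p\<in>topspace M. 0 = J p"
    by (rule form_eq_coeff_vol[OF G exact_wedge11[OF sm(1,2,3) d1]]) (simp_all add: W)
  note J' = J[unfolded topspace_all_iff, rule_format, symmetric]
  have "nowhere_zero A (\<omega>1 \<^bold>\<and>\<^sub>2 ext_d \<omega>1)"
    unfolding nowhere_zero_def using gen_finsler_vol_nonzero[OF G] W(1) by (metis zero_fun_apply)
  then have "cartan_structure A \<omega>1 \<omega>2"
    unfolding cartan_structure_def form_eq_def using sm I'
    by (intro conjI ballI ext) (simp_all add: W)
  then show ?thesis
    unfolding K_cartan_coframe_def using sm d1 J'
    by (simp add: form_eq_def fun_eq_iff gen_finsler_ext_d[OF G] scale2_def wedge11_def)
qed

lemma gen_finsler_13_K_cartan:
  assumes G: "gen_finsler A I J (\<lambda>_. 1) \<omega>1 \<omega>2 \<omega>3"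
  obtains \<kappa> where "smooth_fun A \<kappa>" "K_cartan_structure A \<kappa> \<omega>1 \<omega>3"
proof -
  note sm = gen_finsler_smooth[OF G] and W = gen_finsler_wedge_ext_d[OF G] and D = gen_finsler_ext_d[OF G]
  \<comment> \<open>Comparing coefficients in \<open>d\<omega>1 = \<omega>3 \<and> \<eta>\<close>
    and \<open>d\<omega>3 = \<eta> \<and> \<omega>1\<close> forces this choice: the first equation
    fixes \<open>I\<close> and \<open>- 1\<close>, the second again \<open>- 1\<close> (here
    \<open>K = 1\<close> enters) and \<open>J\<close>.\<close>
  define \<eta> where "\<eta> = scale1 I \<omega>1 + scale1 (\<lambda>_. - 1) \<omega>2 + scale1 J \<omega>3"
  have \<eta>: "\<eta> c x u = I (chart_inv c x) * \<omega>1 c x u - \<omega>2 c x u + J (chart_inv c x) * \<omega>3 c x u" for c x u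
    by (simp add: \<eta>_def scale1_def)
  have sm\<eta>: "smooth_form1 A \<eta>"
    unfolding \<eta>_def
    by (intro smooth_form1_add smooth_form1_scale1 smooth_fun_const sm)
  have d1: "form_eq A (ext_d \<omega>1) (\<omega>3 \<^bold>\<and> \<eta>)" and d3: "form_eq A (ext_d \<omega>3) (\<eta> \<^bold>\<and> \<omega>1)"
    by (simp_all add: form_eq_def fun_eq_iff D wedge11_def \<eta> algebra_simps)
  \<comment> \<open>Closedness turns these products into \<open>\<eta> \<and> d\<omega>3\<close> and
    \<open>\<eta> \<and> d\<omega>1\<close>, in which \<open>\<eta>\<close> occurs twice.\<close>
  have z3: "(\<omega>3 \<^bold>\<and>\<^sub>2 ext_d \<eta>) c x u v w = 0" and z1: "(\<omega>1 \<^bold>\<and>\<^sub>2 ext_d \<eta>) c x u v w = 0"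
    if cx: "c \<in> A" "x \<in> chart_image c" for c x u v w
  proof -
    have "(\<omega>3 \<^bold>\<and>\<^sub>2 ext_d \<eta>) c x = (\<eta> \<^bold>\<and>\<^sub>2 ext_d \<omega>3) c x" "(\<omega>1 \<^bold>\<and>\<^sub>2 ext_d \<eta>) c x = (\<eta> \<^bold>\<and>\<^sub>2 ext_d \<omega>1) c x"
      using exact_wedge11[OF sm(1,3) sm\<eta> d1] exact_wedge11[OF sm(3) sm\<eta> sm(1) d3] cx
      by (simp_all add: form_eq_def)
    moreover have "ext_d \<omega>1 c x = (\<omega>3 \<^bold>\<and> \<eta>) c x" "ext_d \<omega>3 c x = (\<eta> \<^bold>\<and> \<omega>1) c x"
      using d1 d3 cx by (simp_all add: form_eq_def)
    ultimately show "(\<omega>3 \<^bold>\<and>\<^sub>2 ext_d \<eta>) c x u v w = 0" "(\<omega>1 \<^bold>\<and>\<^sub>2 ext_d \<eta>) c x u v w = 0"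
      by (simp_all add: wedge12_def wedge11_def algebra_simps)
  qed
  \<comment> \<open>A 2-form annihilated by \<open>\<omega>1\<close> and \<open>\<omega>3\<close> is
    a multiple of \<open>\<omega>1 \<and> \<omega>3\<close>: inserting the dual vectors
    \<open>e1\<close> and \<open>e3\<close> into \<open>z1\<close> and \<open>z3\<close> expresses
    it by its value on \<open>(e1, e3)\<close>. The factor is found pointwise here, without
    smoothness.\<close>
  have ex: "\<exists>k. \<forall>u v. ext_d \<eta> c x u v = k * (\<omega>1 \<^bold>\<and> \<omega>3) c x u v" if cx: "c \<in> A" "x \<in> chart_image c" for c x
  proof -
    have "coframing A \<omega>1 \<omega>2 \<omega>3" using G by (simp add: gen_finsler_def)
    from coframing_frame[OF this cx] obtain e1 e3 where
      e: "\<omega>1 c x e1 = 1" "\<omega>3 c x e1 = 0" "\<omega>3 c x e3 = 1" by metis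
    have anti: "ext_d \<eta> c x e3 e1 = - ext_d \<eta> c x e1 e3" by (simp add: ext_d_def)
    have 1: "ext_d \<eta> c x u v = \<omega>1 c x u * ext_d \<eta> c x e1 v - \<omega>1 c x v * ext_d \<eta> c x e1 u" for u v
      using z1[OF cx, of e1 u v] e by (simp add: wedge12_def)
    have 2: "ext_d \<eta> c x e1 v = \<omega>3 c x v * ext_d \<eta> c x e1 e3" for v
      using z3[OF cx, of e3 e1 v] e anti by (simp add: wedge12_def)
    have "ext_d \<eta> c x u v = ext_d \<eta> c x e1 e3 * (\<omega>1 \<^bold>\<and> \<omega>3) c x u v" for u v
      unfolding 1[of u v] 2[of u] 2[of v] by (simp add: wedge11_def algebra_simps)
    then show ?thesis by blast
  qed
  define vol where "vol = \<omega>1 \<^bold>\<and>\<^sub>2 \<omega>2 \<^bold>\<and> \<omega>3"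
  \<comment> \<open>\<open>d\<eta> = \<kappa> \<omega>1 \<and> \<omega>3\<close> implies \<open>\<omega>2 \<and> d\<eta> = - \<kappa> vol\<close>, so \<open>\<kappa>\<close> is a quotient of smooth functions.\<close>
  define k where "k c x = - (\<omega>2 \<^bold>\<and>\<^sub>2 ext_d \<eta>) c x (axis 1 1) (axis 2 1) (axis 3 1) /
    vol c x (axis 1 1) (axis 2 1) (axis 3 1)" for c x
  have nz: "vol c x (axis 1 1) (axis 2 1) (axis 3 1) \<noteq> 0" if "c \<in> A" "x \<in> chart_image c" for c x
    using gen_finsler_vol_nonzero[OF G that] by (simp add: vol_def)
  \<comment> \<open>The pointwise factor is identified with the explicit quotient \<open>k\<close>.
    \<open>k_vol\<close> concerns arbitrary vectors because transition maps do not preserve the axis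
    vectors.\<close>
  have k: "ext_d \<eta> c x u v = k c x * (\<omega>1 \<^bold>\<and> \<omega>3) c x u v"
    and k_vol: "(\<omega>2 \<^bold>\<and>\<^sub>2 ext_d \<eta>) c x u v w = - k c x * vol c x u v w"
    if cx: "c \<in> A" "x \<in> chart_image c" for c x u v w
  proof -
    obtain l where l: "\<And>u v. ext_d \<eta> c x u v = l * (\<omega>1 \<^bold>\<and> \<omega>3) c x u v" using ex[OF cx] by blast
    have l_vol: "(\<omega>2 \<^bold>\<and>\<^sub>2 ext_d \<eta>) c x u v w = - l * vol c x u v w" for u v w
      by (simp add: vol_def wedge12_def wedge11_def l algebra_simps)
    have "l = k c x" unfolding k_def l_vol using nz[OF cx] by simp
    with l l_vol show "ext_d \<eta> c x u v = k c x * (\<omega>1 \<^bold>\<and> \<omega>3) c x u v"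
      "(\<omega>2 \<^bold>\<and>\<^sub>2 ext_d \<eta>) c x u v w = - k c x * vol c x u v w" by auto
  qed
  have "smooth_on (chart_image c) (k c)" if c: "c \<in> A" for c
    unfolding k_def[abs_def] vol_def wedge12_def wedge11_def ext_d_def
    using nz[OF c, unfolded vol_def wedge12_def wedge11_def]
    by (intro smooth_on_divide smooth_on_intros open_chart_image[OF c] smooth_form1_smooth[OF _ c] sm sm\<eta>)
  \<comment> \<open>Both \<open>\<omega>2 \<and> d\<eta>\<close> and \<open>vol\<close> are
    compatible with pullback, so their ratio has the same value in either chart.\<close>
  moreover have "k c x = k c' (transition c c' x)" if cx: "c \<in> A" "c' \<in> A" "x \<in> transition_dom c c'" for c c' x
  proof -
    define y and T where "y = transition c c' x" and "T = frechet_derivative (transition c c') (at x)"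
    have x: "x \<in> chart_image c" and y: "y \<in> chart_image c'"
      using subsetD[OF transition_dom_subset cx(3)] transition_in_chart_image[OF chart_on[OF cx(1)] cx(3)]
      by (simp_all add: y_def)
    have "(\<omega>2 \<^bold>\<and>\<^sub>2 ext_d \<eta>) c x u v w = (\<omega>2 \<^bold>\<and>\<^sub>2 ext_d \<eta>) c' y (T u) (T v) (T w)" for u v w
      unfolding wedge12_def y_def T_def
      by (simp only: smooth_form1_transition[OF sm(2) cx] ext_d_transition[OF sm\<eta> cx])
    moreover have "vol c x u v w = vol c' y (T u) (T v) (T w)" for u v w
      unfolding vol_def wedge12_def wedge11_def y_def T_def
      by (simp only: smooth_form1_transition[OF sm(1) cx] smooth_form1_transition[OF sm(2) cx]
        smooth_form1_transition[OF sm(3) cx])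
    ultimately have "k c' y * vol c x u v w = k c x * vol c x u v w" for u v w
      using k_vol[OF cx(1) x, of u v w] k_vol[OF cx(2) y, of "T u" "T v" "T w"] by simp
    from this[of "axis 1 1" "axis 2 1" "axis 3 1"] show ?thesis using nz[OF cx(1) x] by (simp add: y_def)
  qed
  ultimately have "\<exists>\<kappa>. smooth_fun A \<kappa> \<and> (\<forall>c\<in>A. \<forall>x\<in>chart_image c. \<kappa> (chart_inv c x) = k c x)"
    by (rule glue_smooth_fun)
  then obtain \<kappa> where \<kappa>: "smooth_fun A \<kappa>"
    "\<And>c x. c \<in> A \<Longrightarrow> x \<in> chart_image c \<Longrightarrow> \<kappa> (chart_inv c x) = k c x"
    by blast
  have "nowhere_zero A (\<omega>1 \<^bold>\<and>\<^sub>2 ext_d \<omega>1)"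
    unfolding nowhere_zero_def using gen_finsler_vol_nonzero[OF G] W(1) by (metis zero_fun_apply)
  then have "cartan_structure A \<omega>1 \<omega>3"
    unfolding cartan_structure_def form_eq_def using sm by (intro conjI ballI ext) (simp_all add: W)
  moreover have "form_eq A (ext_d \<eta>) (\<kappa> \<odot> \<omega>1 \<^bold>\<and> \<omega>3)"
    by (simp add: form_eq_def fun_eq_iff scale2_def k \<kappa>)
  ultimately have "K_cartan_structure A \<kappa> \<omega>1 \<omega>3"
    unfolding K_cartan_structure_def K_cartan_coframe_def using sm\<eta> d1 d3 by blast
  with \<kappa>(1) show thesis by (rule that)
qed

text \<open>The coframing determines its third coefficient:
  \<open>\<omega>3 \<and> d\<omega>3\<close> is \<open>K\<close> times the volume form for one
  structure and \<open>k\<close> times it for the other.\<close>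

lemma gen_finsler_const_iff:
  assumes G: "gen_finsler A I J K \<omega>1 \<omega>2 \<omega>3"
  shows "gen_finsler A I J (\<lambda>_. k) \<omega>1 \<omega>2 \<omega>3 \<longleftrightarrow> (\<forall>p\<in>topspace M. K p = k)"
proof
  assume "gen_finsler A I J (\<lambda>_. k) \<omega>1 \<omega>2 \<omega>3"
  from gen_finsler_wedge_ext_d(9)[OF this] gen_finsler_wedge_ext_d(9)[OF G]
  show "\<forall>p\<in>topspace M. K p = k"
    by (intro form_eq_coeff_vol[OF G, of "\<omega>3 \<^bold>\<and>\<^sub>2 ext_d \<omega>3" "\<omega>3 \<^bold>\<and>\<^sub>2 ext_d \<omega>3"]) (simp_all add: form_eq_def)
next
  assume "\<forall>p\<in>topspace M. K p = k"
  then show "gen_finsler A I J (\<lambda>_. k) \<omega>1 \<omega>2 \<omega>3"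
    using G smooth_fun_const
    by (simp add: topspace_all_iff gen_finsler_def form_eq_def scale2_def fun_eq_iff)
qed

text \<open>Closedness of \<open>\<omega>1 \<and> \<omega>2\<close> reads
  \<open>\<omega>2 \<and> d\<omega>1 = \<omega>1 \<and> d\<omega>2\<close>, that is,
  \<open>I\<close> times the volume form is zero.\<close>

lemma gen_finsler_K1_J0_imp_I0:
  assumes G: "gen_finsler A I J K \<omega>1 \<omega>2 \<omega>3" and KJ: "\<forall>p\<in>topspace M. K p = 1 \<and> J p = 0"
  shows "\<forall>p\<in>topspace M. I p = 0"
proof -
  have "form_eq A (ext_d \<omega>3) (\<omega>1 \<^bold>\<and> \<omega>2)"
    using KJ by (simp add: topspace_all_iff form_eq_def fun_eq_iff gen_finsler_ext_d[OF G])
  from exact_wedge11[OF gen_finsler_smooth(3,1,2)[OF G] this] show ?thesis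
    by (rule form_eq_coeff_vol[OF G]) (simp_all add: gen_finsler_wedge_ext_d[OF G])
qed

end

theorem proposition4p1:
  fixes \<Sigma> :: "'a topology" and A :: "'a chart set"
    and I J K :: "'a \<Rightarrow> real" and \<omega>1 \<omega>2 \<omega>3 :: "'a form1"
  assumes "closed_3manifold \<Sigma> A"
    and "gen_finsler A I J K \<omega>1 \<omega>2 \<omega>3"
  shows
    "((taut_contact_circle A \<omega>1 \<omega>2 \<longleftrightarrow> (\<forall>p\<in>topspace \<Sigma>. I p = 0)) \<and>
      ((\<forall>p\<in>topspace \<Sigma>. I p = 0) \<longleftrightarrow> K_cartan_coframe A K \<omega>1 \<omega>2 \<omega>3)) \<and>
     ((taut_contact_circle A \<omega>1 \<omega>3 \<longleftrightarrow> (\<forall>p\<in>topspace \<Sigma>. K p = 1)) \<and>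
      ((\<forall>p\<in>topspace \<Sigma>. K p = 1) \<longleftrightarrow> gen_finsler A I J (\<lambda>_. 1) \<omega>1 \<omega>2 \<omega>3) \<and>
      (taut_contact_circle A \<omega>1 \<omega>3 \<longrightarrow>
         (\<exists>\<kappa>. smooth_fun A \<kappa> \<and> K_cartan_structure A \<kappa> \<omega>1 \<omega>3))) \<and>
     ((taut_contact_circle A \<omega>2 \<omega>3 \<longleftrightarrow> (\<forall>p\<in>topspace \<Sigma>. K p = 1 \<and> J p = 0)) \<and>
      (taut_contact_circle A \<omega>2 \<omega>3 \<longrightarrow>
         (\<forall>p\<in>topspace \<Sigma>. I p = 0) \<and> K_cartan_coframe A (\<lambda>_. 1) \<omega>1 \<omega>2 \<omega>3))"
proof -
  have atlas: "smooth_atlas \<Sigma> A"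
    using assms(1) by (simp add: closed_3manifold_def smooth_3manifold_def)
  note G = assms(2)
  note sm = gen_finsler_smooth[OF G] and W = gen_finsler_wedge_ext_d[OF G]
  \<comment> \<open>In the three equivalences \<open>(q, r)\<close> is \<open>(1, I)\<close>,
    \<open>(K, 0)\<close> and \<open>(K, J)\<close>, by the table of products.\<close>
  have 12: "taut_contact_circle A \<omega>1 \<omega>2 \<longleftrightarrow> (\<forall>p\<in>topspace \<Sigma>. I p = 0)"
    using taut_contact_circle_iff_coeffs[OF atlas G sm(1,2), of "\<lambda>_. 1" I] by (simp add: W)
  have 13: "taut_contact_circle A \<omega>1 \<omega>3 \<longleftrightarrow> (\<forall>p\<in>topspace \<Sigma>. K p = 1)"
    using taut_contact_circle_iff_coeffs[OF atlas G sm(1,3), of K "\<lambda>_. 0"] by (simp add: W)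
  have 23: "taut_contact_circle A \<omega>2 \<omega>3 \<longleftrightarrow> (\<forall>p\<in>topspace \<Sigma>. K p = 1 \<and> J p = 0)"
    using taut_contact_circle_iff_coeffs[OF atlas G sm(2,3), of K J] by (simp add: W)
  \<comment> \<open>A Cartan structure has \<open>\<omega>2 \<and> d\<omega>1 = 0\<close>, whereas
    this form is \<open>I\<close> times the volume form.\<close>
  have "\<forall>p\<in>topspace \<Sigma>. I p = 0" if "K_cartan_coframe A K \<omega>1 \<omega>2 \<omega>3"
  proof (rule form_eq_coeff_vol[OF atlas G])
    show "form_eq A (\<omega>2 \<^bold>\<and>\<^sub>2 ext_d \<omega>1) 0"
      using that by (simp add: K_cartan_coframe_def cartan_structure_def)
  qed (simp_all add: W)
  moreover have const: "(\<forall>p\<in>topspace \<Sigma>. K p = 1) \<longleftrightarrow> gen_finsler A I J (\<lambda>_. 1) \<omega>1 \<omega>2 \<omega>3"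
    using gen_finsler_const_iff[OF atlas G] by simp
  moreover have "\<exists>\<kappa>. smooth_fun A \<kappa> \<and> K_cartan_structure A \<kappa> \<omega>1 \<omega>3" if "taut_contact_circle A \<omega>1 \<omega>3"
    using gen_finsler_13_K_cartan[OF atlas] that const 13 by metis
  moreover have "(\<forall>p\<in>topspace \<Sigma>. I p = 0) \<and> K_cartan_coframe A (\<lambda>_. 1) \<omega>1 \<omega>2 \<omega>3"
    if "taut_contact_circle A \<omega>2 \<omega>3"
  proof -
    have KJ: "\<forall>p\<in>topspace \<Sigma>. K p = 1 \<and> J p = 0" using that 23 by simp
    have I: "\<forall>p\<in>topspace \<Sigma>. I p = 0" by (rule gen_finsler_K1_J0_imp_I0[OF atlas G KJ])
    \<comment> \<open>Replacing \<open>K\<close> by the constant 1 first lets the result for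
      \<open>I = 0\<close> deliver a 1-Cartan coframe.\<close>
    have "gen_finsler A I J (\<lambda>_. 1) \<omega>1 \<omega>2 \<omega>3" using KJ const by simp
    from gen_finsler_K_cartan_coframe[OF atlas this I] I show ?thesis by simp
  qed
  ultimately show ?thesis
    using 12 13 23 gen_finsler_K_cartan_coframe[OF atlas G] by blast
qed

end
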